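(* Let $(\Gamma,x_0)$ be a rooted tree with height $\mathrm{ht}(\Gamma)\ge1$ and let $t$ be a positive integer such that $\left\lceil\frac{\mathrm{ht}(\Gamma)+1}{2}\right\rceil\le t\le\mathrm{ht}(\Gamma)+1$. Then $$\mathrm{reg}\left(\frac{R}{I_t(\Gamma)}\right)\le\sum_{\ell_\Gamma(x)=\mathrm{ht}(\Gamma)-t}^{\mathrm{ht}(\Gamma)-2}\deg_\Gamma^+(x)+\sum_{i=t-1}^{\mathrm{ht}(\Gamma)-2}(\mathrm{ht}(\Gamma)-i-1)\,l_i(\Gamma),$$ where $l_i(\Gamma)$ denotes the number of leaves of $\Gamma$ at level $i$. The first sum is over all vertices $x$ of $\Gamma$ with $\mathrm{ht}(\Gamma)-t\le\ell_\Gamma(x)\le\mathrm{ht}(\Gamma)-2$, with the convention that level $-1$ (which occurs in the range only when $t=\mathrm{ht}(\Gamma)+1$) contributes exactly $1$.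
   Context: A rooted tree $(\Gamma,x_0)$ is a finite tree with a distinguished vertex $x_0$ (the root), viewed as a directed graph with all edges directed away from the root. $R$ is the polynomial ring over a field $\mathsf{k}$ whose variables are the vertices of $\Gamma$. The $t$-path ideal $I_t(\Gamma)\subset R$ is generated by the monomials $x_{i_1}\cdots x_{i_t}$ such that $x_{i_1},\dots,x_{i_t}$ is a directed path on $t$ vertices in $\Gamma$. The outdegree $\deg^+_\Gamma(x)$ is the number of edges directed away from $x$; a leaf is a vertex of outdegree $0$. The level $\ell_\Gamma(x)$ is the length (number of edges) of the unique directed path from $x_0$ to $x$; the height $\mathrm{ht}(\Gamma)$ is the maximum level. $\mathrm{reg}$ denotes Castelnuovo–Mumford regularity. Empty sums are $0$. *)

theory Defs
  imports
    "HOL-Library.Poly_Mapping"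
    "HOL-Library.Extended_Real"
    "Graph_Theory.Graph_Theory"
    "Jordan_Normal_Form.Matrix_Kernel"
begin

text \<open>
  A rooted tree is a finite digraph whose underlying undirected graph is a tree and all of whose
  arcs point away from the root.  The constant \<open>tree\<close> of the graph library is not used: its
  acyclicity only forbids directed cycles, so it admits the diamond, while an edge of a symmetric
  digraph counts there as a cycle of length 2.  Acyclicity is therefore stated for cycles with at
  least three vertices in the symmetric closure, loops and antiparallel arcs being excluded
  separately.
\<close>

definition rooted_tree :: "'v pair_pre_digraph \<Rightarrow> 'v \<Rightarrow> bool" where
  "rooted_tree \<Gamma> x\<^sub>0 \<longleftrightarrow>
     pair_digraph \<Gamma> \<and> x\<^sub>0 \<in> pverts \<Gamma> \<and>
     (\<forall>x y. (x, y) \<in> parcs \<Gamma> \<longrightarrow> (y, x) \<notin> parcs \<Gamma>) \<and>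
     connected \<Gamma> \<and>
     \<not> (\<exists>p. vpath p (mk_symmetric \<Gamma>) \<and> length p \<ge> 3 \<and>
            (last p, hd p) \<in> parcs (mk_symmetric \<Gamma>)) \<and>
     (\<forall>x y p. (x, y) \<in> parcs \<Gamma> \<and> vpath p (mk_symmetric \<Gamma>) \<and> hd p = x\<^sub>0 \<and> last p = y
        \<longrightarrow> x \<in> set p)"

definition level :: "'v pair_pre_digraph \<Rightarrow> 'v \<Rightarrow> 'v \<Rightarrow> nat" where
  "level \<Gamma> x\<^sub>0 x = vwalk_length (THE p. vpath p \<Gamma> \<and> hd p = x\<^sub>0 \<and> last p = x)"

definition height :: "'v pair_pre_digraph \<Rightarrow> 'v \<Rightarrow> nat" where
  "height \<Gamma> x\<^sub>0 = Max (level \<Gamma> x\<^sub>0 ` pverts \<Gamma>)"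

definition leaf :: "'v pair_pre_digraph \<Rightarrow> 'v \<Rightarrow> bool" where
  "leaf \<Gamma> x \<longleftrightarrow> x \<in> pverts \<Gamma> \<and> out_degree \<Gamma> x = 0"

text \<open>Levels are integers here, because the sums in which these occur may start at level \<open>-1\<close>.\<close>

definition level_set :: "'v pair_pre_digraph \<Rightarrow> 'v \<Rightarrow> int \<Rightarrow> 'v set" where
  "level_set \<Gamma> x\<^sub>0 i = {x \<in> pverts \<Gamma>. int (level \<Gamma> x\<^sub>0 x) = i}"

definition num_leaves_at :: "'v pair_pre_digraph \<Rightarrow> 'v \<Rightarrow> int \<Rightarrow> nat" where
  "num_leaves_at \<Gamma> x\<^sub>0 i = card {x \<in> level_set \<Gamma> x\<^sub>0 i. leaf \<Gamma> x}"

text \<open>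
  \<open>('v, 'k) mpoly\<close> is the polynomial ring over \<open>'k\<close> with one variable for each element of \<open>'v\<close>;
  a monomial is its exponent function.
\<close>

type_synonym ('v, 'k) mpoly = "('v \<Rightarrow>\<^sub>0 nat) \<Rightarrow>\<^sub>0 'k"

definition Var :: "'v \<Rightarrow> ('v, 'k::comm_ring_1) mpoly" where
  "Var v = Poly_Mapping.single (Poly_Mapping.single v 1) 1"

text \<open>The ideal generated by \<open>S\<close> is the span of \<open>S\<close> in the ring regarded as a module over itself.\<close>

definition ideal_gen :: "'r::comm_ring_1 set \<Rightarrow> 'r set" where
  "ideal_gen S = Modules.module.span (*) S"

definition path_ideal :: "nat \<Rightarrow> 'v pair_pre_digraph \<Rightarrow> ('v, 'k::comm_ring_1) mpoly set" where
  "path_ideal t \<Gamma> = ideal_gen {prod_list (map Var p) | p. vpath p \<Gamma> \<and> length p = t}"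

definition monom_degree :: "('v \<Rightarrow>\<^sub>0 nat) \<Rightarrow> nat" where
  "monom_degree m = (\<Sum>v \<in> Poly_Mapping.keys m. Poly_Mapping.lookup m v)"

text \<open>The zero polynomial is homogeneous of every degree, and the only one of negative degree.\<close>

definition homogeneous :: "int \<Rightarrow> ('v, 'k::zero) mpoly \<Rightarrow> bool" where
  "homogeneous d f \<longleftrightarrow> (\<forall>m \<in> Poly_Mapping.keys f. int (monom_degree m) = d)"

text \<open>
  With \<open>R\<close> the polynomial ring, \<open>graded_free_resolution I n a \<epsilon> D\<close> describes
  an exact complex \<open>\<dots> \<rightarrow> F\<^sub>2 \<rightarrow> F\<^sub>1 \<rightarrow> F\<^sub>0 \<rightarrow> R/I \<rightarrow> 0\<close> of graded modules and degree-preserving maps.  Here \<open>F\<^sub>i\<close> is free of rank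
  \<open>n i\<close>, its \<open>j\<close>-th basis element having degree \<open>a i j\<close> (that is, \<open>F\<^sub>i\<close> is the direct sum of the
  shifts \<open>R(- a i j)\<close>); the map from \<open>F\<^sub>i\<^sub>+\<^sub>1\<close> to \<open>F\<^sub>i\<close> has matrix \<open>D (Suc i)\<close> (the value \<open>D 0\<close> is not
  used); and the \<open>j\<close>-th basis element of \<open>F\<^sub>0\<close> goes to the residue class of \<open>\<epsilon> $ j\<close>.
\<close>

definition graded_free_resolution ::
  "('v, 'k::field) mpoly set \<Rightarrow> (nat \<Rightarrow> nat) \<Rightarrow> (nat \<Rightarrow> nat \<Rightarrow> int) \<Rightarrow>
     ('v, 'k) mpoly vec \<Rightarrow> (nat \<Rightarrow> ('v, 'k) mpoly mat) \<Rightarrow> bool" where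
  "graded_free_resolution I n a \<epsilon> D \<longleftrightarrow>
     \<epsilon> \<in> carrier_vec (n 0) \<and>
     (\<forall>j < n 0. homogeneous (a 0 j) (\<epsilon> $ j)) \<and>
     (\<forall>i. D (Suc i) \<in> carrier_mat (n i) (n (Suc i))) \<and>
     (\<forall>i. \<forall>k < n i. \<forall>j < n (Suc i). homogeneous (a (Suc i) j - a i k) (D (Suc i) $$ (k, j))) \<and>
     (\<forall>f. \<exists>c \<in> carrier_vec (n 0). f - \<epsilon> \<bullet> c \<in> I) \<and>
     {c \<in> carrier_vec (n 0). \<epsilon> \<bullet> c \<in> I} = (\<lambda>c. D (Suc 0) *\<^sub>v c) ` carrier_vec (n (Suc 0)) \<and>
     (\<forall>i. mat_kernel (D (Suc i)) = (\<lambda>c. D (Suc (Suc i)) *\<^sub>v c) ` carrier_vec (n (Suc (Suc i))))"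

text \<open>Minimality: the image of each differential lies in \<open>\<mm> F\<^sub>i\<close>, \<open>\<mm>\<close> being generated by the variables.\<close>

definition minimal_graded_free_resolution ::
  "('v, 'k::field) mpoly set \<Rightarrow> (nat \<Rightarrow> nat) \<Rightarrow> (nat \<Rightarrow> nat \<Rightarrow> int) \<Rightarrow>
     ('v, 'k) mpoly vec \<Rightarrow> (nat \<Rightarrow> ('v, 'k) mpoly mat) \<Rightarrow> bool" where
  "minimal_graded_free_resolution I n a \<epsilon> D \<longleftrightarrow>
     graded_free_resolution I n a \<epsilon> D \<and>
     (\<forall>i. \<forall>k < n i. \<forall>j < n (Suc i). D (Suc i) $$ (k, j) \<in> ideal_gen (range Var))"

text \<open>
  The regularity of \<open>R/I\<close>, for a homogeneous ideal \<open>I\<close> and finitely many variables, is the largest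
  \<open>d - i\<close> such that the minimal graded free resolution of \<open>R/I\<close> has a basis element of degree \<open>d\<close> in
  homological degree \<open>i\<close>.  That resolution exists and is unique up to isomorphism, so the supremum
  over all of them is the value for any one of them.  It is \<open>-\<infinity>\<close> for the zero module.
\<close>

definition reg_quotient :: "('v, 'k::field) mpoly set \<Rightarrow> ereal" where
  "reg_quotient I = Sup {ereal (of_int (a i j - int i)) | n a \<epsilon> D i j.
     minimal_graded_free_resolution I n a \<epsilon> D \<and> j < n i}"

end

theory Submission
  imports Defs "HOL-Library.Countable"
begin

text \<open>
  The regularity of \<open>R/I\<close> is accessible through the Koszul complex \<open>K\<close> of the variables: if the
  homology of \<open>K \<otimes> R/I\<close> vanishes in homological degree \<open>p\<close> and internal degree \<open>d\<close> whenever
  \<open>d - p > r\<close>, then in every minimal graded free resolution \<open>F\<close> of \<open>R/I\<close> the basis elements of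
  \<open>F\<^sub>i\<close> have degree at most \<open>r + i\<close>.  This is a diagram chase in \<open>K \<otimes> F\<close>
  (\<open>resolution_staircase\<close>, \<open>reg_quotient_le\<close>), which starts with a basis element \<open>e\<close> of
  \<open>F\<^sub>i\<close>, moves down to a Koszul cycle of \<open>R/I\<close> in homological degree \<open>i\<close>, and returns with \<open>e\<close>
  written as an element of \<open>\<mm> F\<^sub>i\<close> if that cycle bounds.

  For a squarefree monomial ideal \<open>I\<close> and a variable \<open>x\<close> the exact sequence
  \<open>0 \<rightarrow> R/(I : x)(-1) \<rightarrow> R/I \<rightarrow> R/(I + (x)) \<rightarrow> 0\<close> bounds the regularity of \<open>R/I\<close> by the
  maximum of that of \<open>R/(I + (x))\<close> and one more than that of \<open>R/(I : x)\<close> (\<open>koszul_reg_le_split\<close>).  Both ideals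
  are again of the same kind, so the theorem becomes a question about the cost of a sequence of
  decisions: each chosen variable is either divided out, at cost 1, or added to the ideal, free of
  charge.  When the ideal has generators of degrees \<open>d\<^sub>1, d\<^sub>2, \<dots>\<close>, the remaining cost is at most the
  sum of the numbers \<open>d\<^sub>j - 1\<close> (\<open>koszul_reg_le_sum_card\<close>).

  Let \<open>h\<close> be the height.  The variables chosen for the path ideal are the vertices of levels
  \<open>h - t + 1\<close> to \<open>h - 1\<close>, the band, taken from the root downwards.  The first sum of the bound is the
  number of these vertices.  Every path starts at a level not greater than \<open>h - t + 1\<close>; therefore
  adding a vertex \<open>x\<close> of the band to the ideal makes precisely the paths ending in \<open>x\<close> or
  below it superfluous.  When the band has been processed, the path ending in a vertex \<open>v\<close> is represented by a
  monomial of degree at most \<open>h - \<ell>(v)\<close> (of degree at most 1 if \<open>\<ell>(v) = h\<close>), and this monomial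
  is redundant if \<open>\<ell>(v) < h - 1\<close> and \<open>v\<close> has a child whose subtree has not been removed.  What
  has to be paid at the end is thus \<open>h - \<ell>(v) - 1\<close> for each \<open>v\<close> of level at least \<open>t - 1\<close>
  without such a child.  For the leaves of the tree this is the second sum.  Any other such \<open>v\<close> has
  lost all its children, hence at least one subtree for which nothing had been paid yet, and the amount
  saved there suffices (\<open>kill_gain\<close>): a chain from the root of that subtree to a deepest vertex
  \<open>w\<close> contains an unprocessed vertex of the band at each of its levels below \<open>h\<close>, and
  \<open>h - \<ell>(w) - 1\<close>, which would have been due for \<open>w\<close>, supplies the rest.  The hypothesis \<open>2 t \<ge> h + 1\<close> places all the levels from \<open>t\<close> to
  \<open>h - 1\<close>, at which such children can lie, within the band.
\<close>

section \<open>Arithmetic of monomials\<close>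
lemma lookup_Var_times:
  fixes f :: "('v, 'k::comm_ring_1) mpoly"
  shows "Poly_Mapping.lookup (Var x * f) m =
    (if x \<in> Poly_Mapping.keys m then Poly_Mapping.lookup f (m - Poly_Mapping.single x 1) else 0)"
proof -
  let ?s = "Poly_Mapping.single x (1::nat) :: 'v \<Rightarrow>\<^sub>0 nat"
  have "Poly_Mapping.lookup (Var x * f) m = Sum_any (\<lambda>q. Poly_Mapping.lookup f q when m = ?s + q)"
    unfolding Var_def lookup_mult lookup_single by (simp add: when_mult)
  also have "\<dots> = (if x \<in> Poly_Mapping.keys m then Poly_Mapping.lookup f (m - ?s) else 0)"
  proof (cases "x \<in> Poly_Mapping.keys m")
    case True
    have "m = ?s + q \<longleftrightarrow> q = m - ?s" for q
    proof
      assume "q = m - ?s"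
      then show "m = ?s + q"
        using True by (intro poly_mapping_eqI)
          (auto simp: lookup_add lookup_minus lookup_single when_def in_keys_iff)
    qed auto
    then show ?thesis using True by simp
  next
    case False
    have "m \<noteq> ?s + q" for q
      using False by (auto simp: lookup_add lookup_single in_keys_iff)
    then show ?thesis using False by simp
  qed
  finally show ?thesis .
qed

lemma keys_add_nat:
  fixes m n :: "'v \<Rightarrow>\<^sub>0 nat"
  shows "Poly_Mapping.keys (m + n) = Poly_Mapping.keys m \<union> Poly_Mapping.keys n"
  by (auto simp: in_keys_iff lookup_add)

definition restrict_monoms ::
  "(('v \<Rightarrow>\<^sub>0 nat) \<Rightarrow> bool) \<Rightarrow> ('v, 'k::zero) mpoly \<Rightarrow> ('v, 'k) mpoly" where
  "restrict_monoms P f = Poly_Mapping.mapp (\<lambda>m c. c when P m) f"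

lemma lookup_restrict_monoms: "Poly_Mapping.lookup (restrict_monoms P f) m = (Poly_Mapping.lookup f m when P m)"
  by (auto simp: restrict_monoms_def lookup_mapp when_def in_keys_iff)

lemma keys_restrict_monoms: "Poly_Mapping.keys (restrict_monoms P f) = {m \<in> Poly_Mapping.keys f. P m}"
  by (auto simp: in_keys_iff lookup_restrict_monoms)

text \<open>The quotient of the division of \<open>f\<close> by the variable \<open>x\<close>.\<close>

definition div_var :: "'v \<Rightarrow> ('v, 'k::zero) mpoly \<Rightarrow> ('v, 'k) mpoly" where
  "div_var x f = Poly_Mapping.map_key (\<lambda>m. m + Poly_Mapping.single x 1) f"

lemma lookup_div_var: "Poly_Mapping.lookup (div_var x f) m = Poly_Mapping.lookup f (m + Poly_Mapping.single x 1)"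
  unfolding div_var_def by (subst map_key.rep_eq) (auto intro: injI)

lemma keys_div_var: "m \<in> Poly_Mapping.keys (div_var x f) \<longleftrightarrow> m + Poly_Mapping.single x 1 \<in> Poly_Mapping.keys f"
  by (simp add: in_keys_iff lookup_div_var)

lemma div_var_remainder:
  fixes f :: "('v, 'k::comm_ring_1) mpoly"
  shows "f = restrict_monoms (\<lambda>m. x \<notin> Poly_Mapping.keys m) f + Var x * div_var x f"
proof (rule poly_mapping_eqI)
  fix m :: "'v \<Rightarrow>\<^sub>0 nat"
  have "x \<in> Poly_Mapping.keys m \<Longrightarrow> m - Poly_Mapping.single x 1 + Poly_Mapping.single x 1 = m"
    by (intro poly_mapping_eqI)
      (auto simp: lookup_add lookup_minus lookup_single when_def in_keys_iff)
  then show "Poly_Mapping.lookup f m =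
      Poly_Mapping.lookup (restrict_monoms (\<lambda>m. x \<notin> Poly_Mapping.keys m) f + Var x * div_var x f) m"
    by (simp add: lookup_add lookup_restrict_monoms lookup_Var_times lookup_div_var)
qed

lemma div_var_Var_same: "div_var x (Var x * f) = (f :: ('v, 'k::comm_ring_1) mpoly)"
  by (rule poly_mapping_eqI) (simp add: lookup_div_var lookup_Var_times keys_add_nat)

lemma div_var_Var_other:
  fixes f :: "('v, 'k::comm_ring_1) mpoly"
  assumes "x \<noteq> y"
  shows "div_var x (Var y * f) = Var y * div_var x f"
proof (rule poly_mapping_eqI)
  fix m :: "'v \<Rightarrow>\<^sub>0 nat"
  have "y \<in> Poly_Mapping.keys m \<Longrightarrow> m + Poly_Mapping.single x 1 - Poly_Mapping.single y 1
      = m - Poly_Mapping.single y 1 + Poly_Mapping.single x 1"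
    using assms by (intro poly_mapping_eqI)
      (auto simp: lookup_add lookup_minus lookup_single when_def in_keys_iff)
  then show "Poly_Mapping.lookup (div_var x (Var y * f)) m = Poly_Mapping.lookup (Var y * div_var x f) m"
    using assms by (simp add: lookup_div_var lookup_Var_times keys_add_nat)
qed

lemma div_var_add:
  "div_var x (f + g) = div_var x f + (div_var x g :: ('v, 'k::comm_ring_1) mpoly)"
  by (rule poly_mapping_eqI) (simp add: lookup_div_var lookup_add)

lemma div_var_uminus:
  "div_var x (- f) = - (div_var x f :: ('v, 'k::comm_ring_1) mpoly)"
  by (rule poly_mapping_eqI) (simp add: lookup_div_var)

lemma div_var_0 [simp]: "div_var x 0 = 0"
  by (rule poly_mapping_eqI) (simp add: lookup_div_var)

lemma div_var_sum:
  "div_var x (sum f A) = (\<Sum>a\<in>A. div_var x (f a :: ('v, 'k::comm_ring_1) mpoly))"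
  by (induction A rule: infinite_finite_induct) (auto simp: div_var_add)

lemma monom_degree_eq_sum: "monom_degree (m :: 'v::finite \<Rightarrow>\<^sub>0 nat) = (\<Sum>v\<in>UNIV. Poly_Mapping.lookup m v)"
  unfolding monom_degree_def by (intro sum.mono_neutral_left) (auto simp: in_keys_iff)

lemma monom_degree_add:
  "monom_degree (m + n :: 'v::finite \<Rightarrow>\<^sub>0 nat) = monom_degree m + monom_degree n"
  by (simp add: monom_degree_eq_sum lookup_add sum.distrib)

lemma monom_degree_single [simp]: "monom_degree (Poly_Mapping.single x n) = n"
  by (simp add: monom_degree_def)

lemma homogeneous_0 [simp]: "homogeneous d 0"
  by (simp add: homogeneous_def)

lemma homogeneous_add:
  "homogeneous d f \<Longrightarrow> homogeneous d g \<Longrightarrow> homogeneous d (f + g :: ('v, 'k::comm_ring_1) mpoly)"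
  unfolding homogeneous_def using keys_add[of f g] by blast

lemma homogeneous_uminus [simp]:
  "homogeneous d (- f :: ('v, 'k::comm_ring_1) mpoly) \<longleftrightarrow> homogeneous d f"
  by (simp add: homogeneous_def in_keys_iff)

lemma homogeneous_diff:
  "homogeneous d f \<Longrightarrow> homogeneous d g \<Longrightarrow> homogeneous d (f - g :: ('v, 'k::comm_ring_1) mpoly)"
  using homogeneous_add[of d f "- g"] by simp

lemma homogeneous_sum:
  "(\<And>a. a \<in> A \<Longrightarrow> homogeneous d (f a)) \<Longrightarrow>
    homogeneous d (sum f A :: ('v, 'k::comm_ring_1) mpoly)"
  by (induction A rule: infinite_finite_induct) (auto intro: homogeneous_add)

lemma homogeneous_mult:
  fixes f g :: "('v::finite, 'k::comm_ring_1) mpoly"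
  assumes "homogeneous d f" "homogeneous e g"
  shows "homogeneous (d + e) (f * g)"
  unfolding homogeneous_def
proof
  fix m assume "m \<in> Poly_Mapping.keys (f * g)"
  then obtain a b where "m = a + b" "a \<in> Poly_Mapping.keys f" "b \<in> Poly_Mapping.keys g"
    using keys_mult[of f g] by auto
  then show "int (monom_degree m) = d + e"
    using assms by (auto simp: homogeneous_def monom_degree_add)
qed

lemma homogeneous_Var_mult:
  fixes f :: "('v::finite, 'k::comm_ring_1) mpoly"
  assumes "homogeneous (d - 1) f"
  shows "homogeneous d (Var x * f)"
  using homogeneous_mult[OF _ assms, of 1 "Var x"]
  by (simp add: homogeneous_def Var_def)

lemma homogeneous_div_var:
  fixes f :: "('v::finite, 'k::comm_ring_1) mpoly"
  assumes "homogeneous d f"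
  shows "homogeneous (d - 1) (div_var x f)"
  unfolding homogeneous_def
proof
  fix m assume "m \<in> Poly_Mapping.keys (div_var x f)"
  then have "int (monom_degree (m + Poly_Mapping.single x 1)) = d"
    using assms by (simp add: keys_div_var homogeneous_def)
  then show "int (monom_degree m) = d - 1"
    by (simp add: monom_degree_add)
qed

lemma homogeneous_restrict_monoms:
  "homogeneous d f \<Longrightarrow> homogeneous d (restrict_monoms P f)"
  by (simp add: homogeneous_def keys_restrict_monoms)

section \<open>The Koszul complex\<close>
text \<open>
  A Koszul chain is given by its coefficients \<open>z T\<close> at the exterior basis elements
  \<open>e\<^sub>T\<close>, \<open>T\<close> a set of variables.  The order of the variables behind the signs is
  any fixed one; \<open>to_nat\<close> supplies it.
\<close>
definition koszul_sign :: "'v::finite \<Rightarrow> 'v set \<Rightarrow> 'r::comm_ring_1" where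
  "koszul_sign x T = (- 1) ^ card {y \<in> T. to_nat y < to_nat x}"

lemma koszul_sign_cases: "koszul_sign x T = (1 :: 'r::comm_ring_1) \<or> koszul_sign x T = (-1 :: 'r)"
  unfolding koszul_sign_def by (cases "even (card {y \<in> T. to_nat y < to_nat x})") simp_all

lemma koszul_sign_square: "koszul_sign x T * (koszul_sign x T * a) = (a :: 'r::comm_ring_1)"
  using koszul_sign_cases[of x T, where 'r='r] by auto

lemma homogeneous_koszul_sign_mult [simp]:
  "homogeneous d (koszul_sign x T * f :: ('v, 'k::comm_ring_1) mpoly) \<longleftrightarrow> homogeneous d f"
  using koszul_sign_cases[of x T, where 'r="('v, 'k) mpoly"] by auto

lemma koszul_sign_insert:
  "y \<notin> T \<Longrightarrow> koszul_sign x (insert y T) =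
    (if to_nat y < to_nat x then - koszul_sign x T else koszul_sign x T)"
proof -
  have "{z \<in> insert y T. to_nat z < to_nat x} =
      (if to_nat y < to_nat x then insert y {z \<in> T. to_nat z < to_nat x}
       else {z \<in> T. to_nat z < to_nat x})"
    by auto
  then show "y \<notin> T \<Longrightarrow> ?thesis"
    by (simp add: koszul_sign_def)
qed

lemma koszul_sign_exchange:
  assumes "x \<noteq> y" "x \<notin> T" "y \<notin> T"
  shows "koszul_sign x T * koszul_sign y (insert x T) =
    - (koszul_sign y T * koszul_sign x (insert y T) :: 'r::comm_ring_1)"
proof -
  have "to_nat x \<noteq> to_nat y" using assms(1) by simp
  then show ?thesis
    using assms by (auto simp: koszul_sign_insert)
qed

definition koszul_d ::
  "('v::finite set \<Rightarrow> ('v, 'k::comm_ring_1) mpoly) \<Rightarrow> 'v set \<Rightarrow> ('v, 'k) mpoly" where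
  "koszul_d z T = (\<Sum>x \<in> - T. koszul_sign x T * (Var x * z (insert x T)))"

lemma koszul_d_add: "koszul_d (\<lambda>S. f S + g S) T = koszul_d f T + koszul_d g T"
  by (simp add: koszul_d_def distrib_left sum.distrib)

lemma koszul_d_diff: "koszul_d (\<lambda>S. f S - g S) T = koszul_d f T - koszul_d g T"
  by (simp add: koszul_d_def right_diff_distrib sum_subtractf)

lemma koszul_d_mult: "koszul_d (\<lambda>S. c * f S) T = c * koszul_d f T"
  by (simp add: koszul_d_def sum_distrib_left mult.left_commute)

lemma koszul_d_0 [simp]: "koszul_d (\<lambda>S. 0) T = 0"
  by (simp add: koszul_d_def)

lemma koszul_d_sum: "koszul_d (\<lambda>S. \<Sum>a\<in>A. f a S) T = (\<Sum>a\<in>A. koszul_d (f a) T)"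
  by (induction A rule: infinite_finite_induct) (simp_all add: koszul_d_add)

text \<open>
  The sum over ordered pairs \<open>x \<noteq> y\<close> is split into \<open>x < y\<close> and \<open>y < x\<close> instead of being
  compared with its own negative, since \<open>s = - s\<close> says nothing in characteristic 2.
\<close>
lemma koszul_d_koszul_d [simp]: "koszul_d (koszul_d z) T = 0"
proof -
  define g where "g x y = koszul_sign x T * (Var x *
      (koszul_sign y (insert x T) * (Var y * z (insert y (insert x T)))))" for x y
  have flip: "g y x = - g x y" if "x \<noteq> y" "x \<notin> T" "y \<notin> T" for x y
  proof -
    have "g y x = (koszul_sign y T * koszul_sign x (insert y T)) *
        (Var x * (Var y * z (insert y (insert x T))))"
      by (simp add: g_def insert_commute mult_ac)
    also have "\<dots> = - (koszul_sign x T * koszul_sign y (insert x T)) *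
        (Var x * (Var y * z (insert y (insert x T))))"
      using koszul_sign_exchange[OF that, where 'r="('a, 'b) mpoly"] by simp
    finally show ?thesis by (simp add: g_def mult_ac)
  qed
  define P where "P = {(x, y). x \<notin> T \<and> y \<notin> T \<and> to_nat x < to_nat y}"
  have "koszul_d (koszul_d z) T = (\<Sum>x\<in>-T. \<Sum>y\<in>-insert x T. g x y)"
    by (simp add: koszul_d_def g_def sum_distrib_left)
  also have "\<dots> = (\<Sum>(x, y)\<in>Sigma (-T) (\<lambda>x. - insert x T). g x y)"
    by (simp add: sum.Sigma)
  also have "Sigma (-T) (\<lambda>x. - insert x T) = P \<union> prod.swap ` P"
    by (auto simp: P_def image_iff) (metis linorder_neqE_nat to_nat_split)
  also have "(\<Sum>(x, y)\<in>P \<union> prod.swap ` P. g x y)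
      = (\<Sum>(x, y)\<in>P. g x y) + (\<Sum>(x, y)\<in>prod.swap ` P. g x y)"
    by (intro sum.union_disjoint) (auto simp: P_def)
  also have "(\<Sum>(x, y)\<in>prod.swap ` P. g x y) = (\<Sum>(x, y)\<in>P. g y x)"
    by (subst sum.reindex) (auto simp: case_prod_unfold intro: sum.cong)
  also have "\<dots> = (\<Sum>(x, y)\<in>P. - g x y)"
    by (intro sum.cong) (auto simp: P_def intro!: flip)
  finally show ?thesis by (simp add: case_prod_unfold sum_negf)
qed

text \<open>
  The elements of homological degree \<open>p\<close> and internal degree \<open>d\<close>; the basis element
  \<open>e\<^sub>T\<close> has internal degree \<open>card T\<close>.
\<close>
definition koszul_chains :: "nat \<Rightarrow> int \<Rightarrow> ('v::finite set \<Rightarrow> ('v, 'k::comm_ring_1) mpoly) set" where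
  "koszul_chains p d = {z. \<forall>T. (card T \<noteq> p \<longrightarrow> z T = 0) \<and> homogeneous (d - int p) (z T)}"

lemma koszul_chainsI:
  "(\<And>T. card T \<noteq> p \<Longrightarrow> z T = 0) \<Longrightarrow> (\<And>T. card T = p \<Longrightarrow> homogeneous (d - int p) (z T)) \<Longrightarrow>
    z \<in> koszul_chains p d"
  unfolding koszul_chains_def by (smt (verit) homogeneous_0 mem_Collect_eq)

lemma koszul_chains_eq_0: "z \<in> koszul_chains p d \<Longrightarrow> card T \<noteq> p \<Longrightarrow> z T = 0"
  by (simp add: koszul_chains_def)

lemma koszul_chains_homogeneous: "z \<in> koszul_chains p d \<Longrightarrow> homogeneous (d - int p) (z T)"
  by (simp add: koszul_chains_def)

lemma koszul_chains_add:
  "f \<in> koszul_chains p d \<Longrightarrow> g \<in> koszul_chains p d \<Longrightarrow> (\<lambda>T. f T + g T) \<in> koszul_chains p d"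
  by (auto simp: koszul_chains_def intro: homogeneous_add)

lemma koszul_chains_diff:
  "f \<in> koszul_chains p d \<Longrightarrow> g \<in> koszul_chains p d \<Longrightarrow> (\<lambda>T. f T - g T) \<in> koszul_chains p d"
  by (auto simp: koszul_chains_def intro: homogeneous_diff)

lemma koszul_d_chains:
  assumes "z \<in> koszul_chains (Suc p) d"
  shows "koszul_d z \<in> koszul_chains p d"
proof (rule koszul_chainsI)
  fix T :: "'a set" assume "card T \<noteq> p"
  then have "z (insert x T) = 0" if "x \<notin> T" for x
    using that by (intro koszul_chains_eq_0[OF assms]) simp
  then show "koszul_d z T = 0"
    by (simp add: koszul_d_def)
next
  fix T :: "'a set"
  have "homogeneous (d - int p - 1) (z S)" for S
    using koszul_chains_homogeneous[OF assms, of S] by (simp add: algebra_simps)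
  then show "homogeneous (d - int p) (koszul_d z T)"
    unfolding koszul_d_def homogeneous_koszul_sign_mult
    by (intro homogeneous_sum) (simp only: homogeneous_koszul_sign_mult homogeneous_Var_mult)
qed

section \<open>Regularity through Koszul homology\<close>
text \<open>
  The homology of the Koszul complex of \<open>R/I\<close> vanishes in homological degree \<open>p\<close> and internal
  degree \<open>d\<close> whenever \<open>d - p > r\<close>.  Chains of \<open>R/I\<close> are represented by chains of \<open>R\<close>, so
  that all equalities become congruences modulo \<open>I\<close>.  As Koszul homology computes
  \<open>Tor(R/I, k)\<close>, this is the bound \<open>r\<close> on the regularity of \<open>R/I\<close>.
\<close>
definition koszul_reg_le :: "('v::finite, 'k::comm_ring_1) mpoly set \<Rightarrow> nat \<Rightarrow> bool" where
  "koszul_reg_le I r \<longleftrightarrow>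
    (\<forall>p d. \<forall>z \<in> koszul_chains p d. (\<forall>T. koszul_d z T \<in> I) \<longrightarrow> d > int r + int p \<longrightarrow>
      (\<exists>w \<in> koszul_chains (Suc p) d. \<forall>T. z T - koszul_d w T \<in> I))"

text \<open>
  Division by \<open>x\<close> followed by multiplication with \<open>e\<^sub>x\<close>.  This is a homotopy between the
  identity and the projection \<open>drop_var x\<close> to the part of the Koszul complex in which the
  variable \<open>x\<close> occurs neither in the coefficients nor in the basis elements.
\<close>
definition koszul_homotopy ::
  "'v::finite \<Rightarrow> ('v set \<Rightarrow> ('v, 'k::comm_ring_1) mpoly) \<Rightarrow> 'v set \<Rightarrow> ('v, 'k) mpoly" where
  "koszul_homotopy x z T =
    (if x \<in> T then koszul_sign x (T - {x}) * div_var x (z (T - {x})) else 0)"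

definition drop_var ::
  "'v::finite \<Rightarrow> ('v set \<Rightarrow> ('v, 'k::comm_ring_1) mpoly) \<Rightarrow> 'v set \<Rightarrow> ('v, 'k) mpoly" where
  "drop_var x z T =
    (if x \<in> T then 0 else restrict_monoms (\<lambda>m. x \<notin> Poly_Mapping.keys m) (z T))"

lemma div_var_koszul_sign_mult:
  "div_var x (koszul_sign y T * f) = koszul_sign y T * (div_var x f :: ('v::finite, 'k::comm_ring_1) mpoly)"
  using koszul_sign_cases[of y T, where 'r = "('v, 'k) mpoly"] by (auto simp: div_var_uminus)

text \<open>
  At \<open>T\<close> without \<open>x\<close> only one term survives, namely \<open>x\<close> times the quotient of \<open>z T\<close> by
  \<open>x\<close>.  At \<open>T\<close> containing \<open>x\<close> the two composites agree up to sign, except for the single term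
  in which the differential creates a factor \<open>x\<close> that the division removes again.
\<close>
lemma koszul_homotopy:
  "koszul_d (koszul_homotopy x z) T + koszul_homotopy x (koszul_d z) T = z T - drop_var x z T"
proof (cases "x \<in> T")
  case False
  have "koszul_d (koszul_homotopy x z) T =
      (\<Sum>y\<in>-T. if y = x then Var x * div_var x (z T) else 0)"
    unfolding koszul_d_def
  proof (rule sum.cong)
    fix y assume "y \<in> -T"
    then show "koszul_sign y T * (Var y * koszul_homotopy x z (insert y T)) =
        (if y = x then Var x * div_var x (z T) else 0)"
      using False
      by (auto simp: koszul_homotopy_def koszul_sign_square mult.left_commute[of _ "Var _"])
  qed simp
  also have "\<dots> = Var x * div_var x (z T)"
    using False by simp
  also have "\<dots> = z T - drop_var x z T"
    using False div_var_remainder[of "z T" x] by (simp add: drop_var_def algebra_simps)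
  finally show ?thesis
    using False by (simp add: koszul_homotopy_def)
next
  case True
  define U where "U = T - {x}"
  have T: "T = insert x U" "x \<notin> U" using True by (auto simp: U_def)
  define g where "g y = Var y * div_var x (z (insert y U))" for y
  have "koszul_homotopy x (koszul_d z) T =
      koszul_sign x U * (\<Sum>y\<in>-U. koszul_sign y U * div_var x (Var y * z (insert y U)))"
    using True by (simp add: koszul_homotopy_def koszul_d_def div_var_sum
        div_var_koszul_sign_mult flip: U_def)
  also have "-U = insert x (-T)" using T by auto
  also have "(\<Sum>y\<in>insert x (-T). koszul_sign y U * div_var x (Var y * z (insert y U)))
      = koszul_sign x U * z T + (\<Sum>y\<in>-T. koszul_sign y U * g y)"
    using T by (subst sum.insert) (auto simp: div_var_Var_same g_def div_var_Var_other intro!: sum.cong)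
  finally have 1: "koszul_homotopy x (koszul_d z) T =
      z T + (\<Sum>y\<in>-T. koszul_sign x U * koszul_sign y U * g y)"
    by (simp add: distrib_left koszul_sign_square sum_distrib_left mult.assoc)
  have "koszul_d (koszul_homotopy x z) T =
      (\<Sum>y\<in>-T. koszul_sign y (insert x U) * koszul_sign x (insert y U) * g y)"
    unfolding koszul_d_def
  proof (rule sum.cong)
    fix y assume "y \<in> -T"
    then have "insert y T - {x} = insert y U" using T by auto
    then show "koszul_sign y T * (Var y * koszul_homotopy x z (insert y T)) =
        koszul_sign y (insert x U) * koszul_sign x (insert y U) * g y"
      using T by (simp add: koszul_homotopy_def g_def mult_ac)
  qed simp
  also have "\<dots> = (\<Sum>y\<in>-T. - (koszul_sign x U * koszul_sign y U * g y))"
  proof (rule sum.cong)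
    fix y assume "y \<in> -T"
    then have y: "y \<noteq> x" "y \<notin> U" using T by auto
    then have "to_nat y \<noteq> to_nat x" by simp
    then show "koszul_sign y (insert x U) * koszul_sign x (insert y U) * g y =
        - (koszul_sign x U * koszul_sign y U * g y)"
      using y T(2) by (auto simp: koszul_sign_insert mult_ac)
  qed simp
  finally show ?thesis
    using True 1 by (simp add: drop_var_def sum_negf)
qed

lemma koszul_homotopy_chains:
  assumes "z \<in> koszul_chains p d"
  shows "koszul_homotopy x z \<in> koszul_chains (Suc p) d"
proof (rule koszul_chainsI)
  fix T :: "'a set" assume T: "card T \<noteq> Suc p"
  have "card (T - {x}) \<noteq> p" if "x \<in> T"
    using that T by (metis card_Suc_Diff1 finite)
  then show "koszul_homotopy x z T = 0"
    using koszul_chains_eq_0[OF assms] by (simp add: koszul_homotopy_def)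
next
  fix T :: "'a set"
  show "homogeneous (d - int (Suc p)) (koszul_homotopy x z T)"
    using homogeneous_div_var[OF koszul_chains_homogeneous[OF assms, of "T - {x}"], of x]
    by (simp add: koszul_homotopy_def algebra_simps)
qed

lemma drop_var_chains:
  assumes "z \<in> koszul_chains p d"
  shows "drop_var x z \<in> koszul_chains p d"
proof (rule koszul_chainsI)
  fix T :: "'a set" assume "card T \<noteq> p"
  then have "z T = 0" by (rule koszul_chains_eq_0[OF assms])
  then show "drop_var x z T = 0"
    by (auto simp: drop_var_def intro!: poly_mapping_eqI simp: lookup_restrict_monoms)
next
  fix T :: "'a set"
  show "homogeneous (d - int p) (drop_var x z T)"
    using koszul_chains_homogeneous[OF assms, of T]
    by (simp add: drop_var_def homogeneous_restrict_monoms)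
qed

section \<open>Koszul homology of squarefree monomial ideals\<close>
text \<open>
  The ideal generated by the squarefree monomials whose supports are the sets in \<open>E\<close>.  Membership
  can be tested on each monomial separately, which is taken as the definition.
\<close>
definition squarefree_ideal :: "'v set set \<Rightarrow> ('v, 'k::comm_ring_1) mpoly set" where
  "squarefree_ideal E = {f. \<forall>m \<in> Poly_Mapping.keys f. \<exists>e\<in>E. e \<subseteq> Poly_Mapping.keys m}"

lemma squarefree_idealI:
  "(\<And>m. m \<in> Poly_Mapping.keys f \<Longrightarrow> \<exists>e\<in>E. e \<subseteq> Poly_Mapping.keys m) \<Longrightarrow> f \<in> squarefree_ideal E"
  by (simp add: squarefree_ideal_def)

lemma squarefree_idealD:
  "f \<in> squarefree_ideal E \<Longrightarrow> m \<in> Poly_Mapping.keys f \<Longrightarrow> \<exists>e\<in>E. e \<subseteq> Poly_Mapping.keys m"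
  by (simp add: squarefree_ideal_def)

lemma squarefree_ideal_0 [simp]: "0 \<in> squarefree_ideal E"
  by (simp add: squarefree_ideal_def)

lemma squarefree_ideal_add:
  "f \<in> squarefree_ideal E \<Longrightarrow> g \<in> squarefree_ideal E \<Longrightarrow> f + g \<in> squarefree_ideal E"
  unfolding squarefree_ideal_def using keys_add[of f g] by blast

lemma squarefree_ideal_mult:
  assumes "f \<in> squarefree_ideal E"
  shows "c * f \<in> squarefree_ideal E"
proof (rule squarefree_idealI)
  fix m assume "m \<in> Poly_Mapping.keys (c * f)"
  then obtain a b where "m = a + b" "b \<in> Poly_Mapping.keys f"
    using keys_mult[of c f] by auto
  then show "\<exists>e\<in>E. e \<subseteq> Poly_Mapping.keys m"
    using squarefree_idealD[OF assms] by (metis keys_add_nat le_supI2)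
qed

lemma squarefree_ideal_uminus: "f \<in> squarefree_ideal E \<Longrightarrow> - f \<in> squarefree_ideal E"
  using squarefree_ideal_mult[of f E "-1"] by simp

lemma squarefree_ideal_diff:
  "f \<in> squarefree_ideal E \<Longrightarrow> g \<in> squarefree_ideal E \<Longrightarrow> f - g \<in> squarefree_ideal E"
  using squarefree_ideal_add[of f E "- g"] squarefree_ideal_uminus by auto

lemma squarefree_ideal_sum:
  "(\<And>a. a \<in> A \<Longrightarrow> f a \<in> squarefree_ideal E) \<Longrightarrow> sum f A \<in> squarefree_ideal E"
  by (induction A rule: infinite_finite_induct) (auto intro: squarefree_ideal_add)

lemma koszul_d_squarefree_ideal:
  "(\<And>T. z T \<in> squarefree_ideal E) \<Longrightarrow> koszul_d z T \<in> squarefree_ideal E"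
  unfolding koszul_d_def by (intro squarefree_ideal_sum squarefree_ideal_mult)

lemma div_var_squarefree_ideal:
  assumes "f \<in> squarefree_ideal E" "x \<notin> \<Union>E"
  shows "div_var x f \<in> squarefree_ideal E"
proof (rule squarefree_idealI)
  fix m assume "m \<in> Poly_Mapping.keys (div_var x f)"
  then obtain e where "e \<in> E" "e \<subseteq> Poly_Mapping.keys (m + Poly_Mapping.single x 1)"
    using squarefree_idealD[OF assms(1)] by (auto simp: keys_div_var)
  then show "\<exists>e\<in>E. e \<subseteq> Poly_Mapping.keys m"
    using assms(2) by (intro bexI[of _ e]) (auto simp: keys_add_nat)
qed

text \<open>
  If no generator involves \<open>x\<close>, then division by \<open>x\<close> preserves the ideal, so the homotopy
  descends to \<open>R/I\<close> and every cycle is homologous to one that does not involve \<open>x\<close>.  The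
  variables of \<open>X\<close> are removed one after the other in this way.
\<close>
lemma cycle_drop_vars:
  fixes z :: "'v::finite set \<Rightarrow> ('v, 'k::comm_ring_1) mpoly"
  assumes z: "z \<in> koszul_chains p d" "\<And>T. koszul_d z T \<in> squarefree_ideal E"
    and "X \<inter> \<Union>E = {}"
  shows "\<exists>w \<in> koszul_chains (Suc p) d. \<exists>z' \<in> koszul_chains p d.
    (\<forall>T. z T - koszul_d w T - z' T \<in> squarefree_ideal E) \<and>
    (\<forall>T. \<forall>x\<in>X. (x \<in> T \<longrightarrow> z' T = 0) \<and> (\<forall>m\<in>Poly_Mapping.keys (z' T). x \<notin> Poly_Mapping.keys m))"
  using finite[of X] assms(3)
proof (induction X rule: finite_induct)
  case empty
  have "(\<lambda>T. 0) \<in> koszul_chains (Suc p) d" by (simp add: koszul_chains_def)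
  then show ?case using z(1) by (intro bexI[of _ "\<lambda>T. 0"] bexI[of _ z]) auto
next
  case (insert x X)
  then obtain w z' where w: "w \<in> koszul_chains (Suc p) d" and z': "z' \<in> koszul_chains p d"
    and zz': "\<And>T. z T - koszul_d w T - z' T \<in> squarefree_ideal E"
    and X: "\<And>T y. y \<in> X \<Longrightarrow> y \<in> T \<Longrightarrow> z' T = 0"
      "\<And>T y m. y \<in> X \<Longrightarrow> m \<in> Poly_Mapping.keys (z' T) \<Longrightarrow> y \<notin> Poly_Mapping.keys m"
    by auto
  have cyc: "koszul_d z' T \<in> squarefree_ideal E" for T
  proof -
    have "koszul_d z T - koszul_d (\<lambda>T. z T - koszul_d w T - z' T) T \<in> squarefree_ideal E"
      by (intro squarefree_ideal_diff z(2) koszul_d_squarefree_ideal zz')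
    then show ?thesis by (simp add: koszul_d_diff)
  qed
  have h: "koszul_homotopy x (koszul_d z') T \<in> squarefree_ideal E" for T
    using insert.prems
    by (auto simp: koszul_homotopy_def intro!: squarefree_ideal_mult div_var_squarefree_ideal cyc)
  show ?case
  proof (intro bexI conjI allI ballI impI)
    fix T
    have "(z T - koszul_d w T - z' T) + koszul_homotopy x (koszul_d z') T \<in> squarefree_ideal E"
      by (intro squarefree_ideal_add zz' h)
    moreover have "koszul_homotopy x (koszul_d z') T =
        z' T - drop_var x z' T - koszul_d (koszul_homotopy x z') T"
      using koszul_homotopy[of x z' T] by (simp add: algebra_simps)
    ultimately show "z T - koszul_d (\<lambda>S. w S + koszul_homotopy x z' S) T - drop_var x z' T
        \<in> squarefree_ideal E"
      by (simp add: koszul_d_add algebra_simps)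
  next
    fix T y assume "y \<in> insert x X" "y \<in> T"
    then show "drop_var x z' T = 0"
      using X(1) by (auto simp: drop_var_def lookup_restrict_monoms intro!: poly_mapping_eqI)
  next
    fix T y m assume "y \<in> insert x X" "m \<in> Poly_Mapping.keys (drop_var x z' T)"
    then show "y \<notin> Poly_Mapping.keys m"
      using X(2) by (auto simp: drop_var_def keys_restrict_monoms split: if_splits)
  qed (intro koszul_chains_add w koszul_homotopy_chains drop_var_chains z')+
qed

lemma lookup_mult_0:
  fixes f g :: "('v, 'k::comm_ring_1) mpoly"
  assumes "Poly_Mapping.lookup f 0 = 0"
  shows "Poly_Mapping.lookup (g * f) 0 = 0"
proof (rule ccontr)
  assume "Poly_Mapping.lookup (g * f) 0 \<noteq> 0"
  then have "0 \<in> Poly_Mapping.keys (g * f)" by (simp add: in_keys_iff)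
  then obtain a b where "a + b = 0" "b \<in> Poly_Mapping.keys f"
    using keys_mult[of g f] by force
  then have "Poly_Mapping.keys b = {}"
    by (metis keys_add_nat keys_zero sup_eq_bot_iff)
  then have "b = 0"
    by (intro poly_mapping_eqI) (auto simp: in_keys_iff)
  then show False
    using \<open>b \<in> Poly_Mapping.keys f\<close> assms by (simp add: in_keys_iff)
qed

lemma lookup_koszul_d_0 [simp]: "Poly_Mapping.lookup (koszul_d z T) 0 = 0"
  unfolding koszul_d_def lookup_sum
  by (intro sum.neutral ballI, rule lookup_mult_0) (simp add: lookup_Var_times)

text \<open>
  For the zero ideal all variables can be removed from a cycle.  What remains is a constant multiple
  of \<open>e\<^sub>\<emptyset>\<close>, and this constant is the one assumed to vanish.
\<close>
lemma koszul_exact: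
  fixes z :: "'v::finite set \<Rightarrow> ('v, 'k::comm_ring_1) mpoly"
  assumes z: "z \<in> koszul_chains p d" "\<And>T. koszul_d z T = 0"
    and 0: "Poly_Mapping.lookup (z {}) 0 = 0"
  shows "\<exists>w \<in> koszul_chains (Suc p) d. \<forall>T. koszul_d w T = z T"
proof -
  have eq: "squarefree_ideal {} = {0 :: ('v, 'k) mpoly}"
    by (auto simp: squarefree_ideal_def)
  obtain w z' where w: "w \<in> koszul_chains (Suc p) d" and z': "z' \<in> koszul_chains p d"
    and zz': "\<And>T. z T - koszul_d w T - z' T = 0"
    and X: "\<And>T y. y \<in> T \<Longrightarrow> z' T = 0"
      "\<And>T y m. m \<in> Poly_Mapping.keys (z' T) \<Longrightarrow> y \<notin> Poly_Mapping.keys m"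
    using cycle_drop_vars[OF z(1), of "{}" UNIV] z(2) unfolding eq by auto
  have "z' {} = 0"
  proof (rule poly_mapping_eqI)
    fix m
    show "Poly_Mapping.lookup (z' {}) m = Poly_Mapping.lookup 0 m"
    proof (cases "m = 0")
      case True
      have "z' {} = z {} - koszul_d w {}" using zz'[of "{}"] by simp
      then show ?thesis using True 0 by (simp add: lookup_minus)
    next
      case False
      then have "\<exists>y. y \<in> Poly_Mapping.keys m"
        by (metis Poly_Mapping.lookup_zero in_keys_iff poly_mapping_eqI)
      then have "m \<notin> Poly_Mapping.keys (z' {})" using X(2) by blast
      then show ?thesis by (simp add: in_keys_iff)
    qed
  qed
  then have "z' T = 0" for T
    using X(1) by (cases "T = {}") auto
  then show ?thesis using w zz' by (metis diff_zero right_minus_eq)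
qed

text \<open>
  The ideal is generated by variables (or is everything).  A cycle may be assumed to involve only
  those variables, and if its internal degree exceeds its homological degree, each coefficient is
  divisible by one of them.
\<close>
lemma koszul_reg_le_variables:
  assumes E: "\<And>e. e \<in> E \<Longrightarrow> card e \<le> 1"
  shows "koszul_reg_le (squarefree_ideal E :: ('v::finite, 'k::comm_ring_1) mpoly set) r"
  unfolding koszul_reg_le_def
proof (intro ballI allI impI)
  fix p d and z :: "'v set \<Rightarrow> ('v, 'k) mpoly"
  assume z: "z \<in> koszul_chains p d" "\<forall>T. koszul_d z T \<in> squarefree_ideal E"
    and d: "int r + int p < d"
  have "- \<Union>E \<inter> \<Union>E = {}" by simp
  from cycle_drop_vars[OF z(1) spec[OF z(2)] this]
  obtain w z' where w: "w \<in> koszul_chains (Suc p) d" and z': "z' \<in> koszul_chains p d"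
    and zz': "\<And>T. z T - koszul_d w T - z' T \<in> squarefree_ideal E"
    and X: "\<And>T y m. y \<in> - \<Union>E \<Longrightarrow> m \<in> Poly_Mapping.keys (z' T) \<Longrightarrow> y \<notin> Poly_Mapping.keys m"
    by auto
  have "z' T \<in> squarefree_ideal E" for T
  proof (rule squarefree_idealI)
    fix m assume m: "m \<in> Poly_Mapping.keys (z' T)"
    then have "monom_degree m > 0"
      using koszul_chains_homogeneous[OF z', of T] d by (auto simp: homogeneous_def)
    then obtain x where x: "x \<in> Poly_Mapping.keys m"
      unfolding monom_degree_def by (metis all_not_in_conv less_irrefl sum.empty)
    then obtain e where e: "e \<in> E" "x \<in> e"
      using X[OF _ m] by blast
    then have "e = {x}"
      using E[OF e(1)] by (auto simp: card_le_Suc0_iff_eq)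
    then show "\<exists>e\<in>E. e \<subseteq> Poly_Mapping.keys m"
      using e x by blast
  qed
  then have "z T - koszul_d w T \<in> squarefree_ideal E" for T
    using squarefree_ideal_add[OF zz'[of T], of "z' T"] by simp
  then show "\<exists>w\<in>koszul_chains (Suc p) d. \<forall>T. z T - koszul_d w T \<in> squarefree_ideal E"
    using w by blast
qed

section \<open>Splitting along a variable\<close>
text \<open>
  The generators of \<open>I : x\<close> and of \<open>I + (x)\<close>, where \<open>I\<close> is generated by \<open>E\<close>.
\<close>
definition colon_edges :: "'v \<Rightarrow> 'v set set \<Rightarrow> 'v set set" where
  "colon_edges x E = (\<lambda>e. e - {x}) ` E"

definition kill_edges :: "'v \<Rightarrow> 'v set set \<Rightarrow> 'v set set" where
  "kill_edges x E = insert {x} {e \<in> E. x \<notin> e}"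

lemma Var_mult_squarefree_ideal_iff:
  fixes f :: "('v::finite, 'k::comm_ring_1) mpoly"
  shows "Var x * f \<in> squarefree_ideal E \<longleftrightarrow> f \<in> squarefree_ideal (colon_edges x E)"
proof -
  have keys: "Poly_Mapping.keys (m + Poly_Mapping.single x 1) = insert x (Poly_Mapping.keys m)"
    for m :: "'v \<Rightarrow>\<^sub>0 nat"
    by (auto simp: keys_add_nat)
  have 1: "(\<exists>e\<in>E. e \<subseteq> insert x A) \<longleftrightarrow> (\<exists>e\<in>colon_edges x E. e \<subseteq> A)" for A
    by (auto simp: colon_edges_def subset_insert_iff)
  show ?thesis
  proof
    assume f: "Var x * f \<in> squarefree_ideal E"
    show "f \<in> squarefree_ideal (colon_edges x E)"
    proof (rule squarefree_idealI)
      fix m assume "m \<in> Poly_Mapping.keys f"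
      then have "m + Poly_Mapping.single x 1 \<in> Poly_Mapping.keys (Var x * f)"
        by (metis div_var_Var_same keys_div_var)
      from squarefree_idealD[OF f this] show "\<exists>e\<in>colon_edges x E. e \<subseteq> Poly_Mapping.keys m"
        by (simp only: keys 1)
    qed
  next
    assume f: "f \<in> squarefree_ideal (colon_edges x E)"
    show "Var x * f \<in> squarefree_ideal E"
    proof (rule squarefree_idealI)
      fix m assume "m \<in> Poly_Mapping.keys (Var x * f)"
      then obtain a where "a \<in> Poly_Mapping.keys f" "m = a + Poly_Mapping.single x 1"
        using keys_mult[of "Var x" f] by (auto simp: Var_def add.commute split: if_splits)
      with squarefree_idealD[OF f] show "\<exists>e\<in>E. e \<subseteq> Poly_Mapping.keys m"
        by (simp only: keys 1)
    qed
  qed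
qed

lemma squarefree_ideal_mono:
  assumes "\<And>e. e \<in> E \<Longrightarrow> \<exists>e'\<in>E'. e' \<subseteq> e"
  shows "squarefree_ideal E \<subseteq> squarefree_ideal E'"
proof
  fix f :: "('a, 'b) mpoly" assume f: "f \<in> squarefree_ideal E"
  show "f \<in> squarefree_ideal E'"
  proof (rule squarefree_idealI)
    fix m assume "m \<in> Poly_Mapping.keys f"
    from squarefree_idealD[OF f this] show "\<exists>e\<in>E'. e \<subseteq> Poly_Mapping.keys m"
      using assms by (meson order_trans)
  qed
qed

text \<open>
  This is exactness in the middle of the homology sequence of
  \<open>0 \<rightarrow> R/(I : x)(-1) \<rightarrow> R/I \<rightarrow> R/(I + (x)) \<rightarrow> 0\<close>.  A cycle \<open>z\<close> modulo \<open>I\<close> bounds modulo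
  \<open>I + (x)\<close>, so up to a boundary it is \<open>i + x u\<close> with \<open>i\<close> in \<open>I\<close>; then \<open>u\<close> is a cycle modulo
  \<open>I : x\<close> whose internal degree is smaller by one, hence it bounds there.
\<close>
lemma koszul_reg_le_split:
  assumes colon: "koszul_reg_le (squarefree_ideal (colon_edges x E) :: ('v::finite, 'k::comm_ring_1) mpoly set) r"
    and kill: "koszul_reg_le (squarefree_ideal (kill_edges x E) :: ('v, 'k) mpoly set) (Suc r)"
  shows "koszul_reg_le (squarefree_ideal E :: ('v, 'k) mpoly set) (Suc r)"
  unfolding koszul_reg_le_def
proof (intro ballI allI impI)
  fix p d and z :: "'v set \<Rightarrow> ('v, 'k) mpoly"
  assume z: "z \<in> koszul_chains p d" "\<forall>T. koszul_d z T \<in> squarefree_ideal E"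
    and d: "int (Suc r) + int p < d"
  define P where "P m \<longleftrightarrow> (\<exists>e\<in>E. x \<notin> e \<and> e \<subseteq> Poly_Mapping.keys m)" for m :: "'v \<Rightarrow>\<^sub>0 nat"
  have "koszul_d z T \<in> squarefree_ideal (kill_edges x E)" for T
  proof -
    have "squarefree_ideal E \<subseteq> (squarefree_ideal (kill_edges x E) :: ('v, 'k) mpoly set)"
    proof (rule squarefree_ideal_mono)
      fix e assume "e \<in> E"
      then show "\<exists>e'\<in>kill_edges x E. e' \<subseteq> e"
        by (cases "x \<in> e") (auto simp: kill_edges_def)
    qed
    then show ?thesis using z(2) by blast
  qed
  then obtain w where w: "w \<in> koszul_chains (Suc p) d"
    and zw: "\<And>T. z T - koszul_d w T \<in> squarefree_ideal (kill_edges x E)"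
    using kill z(1) d unfolding koszul_reg_le_def by blast
  define y where "y = (\<lambda>T. z T - koszul_d w T)"
  have y: "y \<in> koszul_chains p d"
    unfolding y_def by (intro koszul_chains_diff z(1) koszul_d_chains w)
  have zy: "y T \<in> squarefree_ideal (kill_edges x E)" for T
    unfolding y_def by (rule zw)
  \<comment> \<open>The monomials of \<open>y\<close> divisible by a generator without \<open>x\<close> lie in \<open>I\<close>; the others are
    divisible by \<open>x\<close>.\<close>
  define i where "i = (\<lambda>T. restrict_monoms P (y T))"
  define u where "u = (\<lambda>T. div_var x (restrict_monoms (\<lambda>m. \<not> P m) (y T)))"
  have i: "i T \<in> squarefree_ideal E" for T
    by (rule squarefree_idealI) (auto simp: i_def keys_restrict_monoms P_def)
  have "restrict_monoms (\<lambda>m. x \<notin> Poly_Mapping.keys m) (restrict_monoms (\<lambda>m. \<not> P m) (y T)) = 0" for T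
  proof (rule poly_mapping_eqI)
    fix m
    have "Poly_Mapping.lookup (y T) m = 0" if "x \<notin> Poly_Mapping.keys m" "\<not> P m"
    proof (rule ccontr)
      assume "Poly_Mapping.lookup (y T) m \<noteq> 0"
      then have "m \<in> Poly_Mapping.keys (y T)" by (simp add: in_keys_iff)
      with zy[of T] obtain e where "e \<in> kill_edges x E" "e \<subseteq> Poly_Mapping.keys m"
        using squarefree_idealD by blast
      then show False
        using that unfolding kill_edges_def P_def by blast
    qed
    then show "Poly_Mapping.lookup (restrict_monoms (\<lambda>m. x \<notin> Poly_Mapping.keys m)
        (restrict_monoms (\<lambda>m. \<not> P m) (y T))) m = Poly_Mapping.lookup 0 m"
      by (simp add: lookup_restrict_monoms when_def)
  qed
  then have "restrict_monoms (\<lambda>m. \<not> P m) (y T) = Var x * u T" for T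
    using div_var_remainder[of "restrict_monoms (\<lambda>m. \<not> P m) (y T)" x] by (simp add: u_def)
  moreover have "y T = i T + restrict_monoms (\<lambda>m. \<not> P m) (y T)" for T
    unfolding i_def by (rule poly_mapping_eqI) (simp add: lookup_add lookup_restrict_monoms when_def)
  ultimately have yiu: "y T = i T + Var x * u T" for T by simp
  have u: "u \<in> koszul_chains p (d - 1)"
  proof (rule koszul_chainsI)
    fix T :: "'v set" assume "card T \<noteq> p"
    then have "y T = 0" by (rule koszul_chains_eq_0[OF y])
    then show "u T = 0"
      by (auto simp: u_def lookup_div_var lookup_restrict_monoms intro!: poly_mapping_eqI)
  next
    fix T :: "'v set"
    have "homogeneous (d - int p - 1) (u T)"
      unfolding u_def by (intro homogeneous_div_var homogeneous_restrict_monoms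
        koszul_chains_homogeneous[OF y])
    then show "homogeneous (d - 1 - int p) (u T)" by (simp add: algebra_simps)
  qed
  have cycle: "koszul_d u T \<in> squarefree_ideal (colon_edges x E)" for T
  proof -
    have "Var x * koszul_d u T = koszul_d (\<lambda>T. y T - i T) T"
      by (simp add: yiu koszul_d_mult)
    also have "\<dots> = koszul_d z T - koszul_d i T"
      by (simp add: y_def koszul_d_diff)
    also have "\<dots> \<in> squarefree_ideal E"
      using z(2) by (intro squarefree_ideal_diff[OF _ koszul_d_squarefree_ideal] i) blast
    finally show ?thesis by (simp add: Var_mult_squarefree_ideal_iff)
  qed
  have "int r + int p < d - 1" using d by simp
  then obtain v where v: "v \<in> koszul_chains (Suc p) (d - 1)"
    and uv: "\<And>T. u T - koszul_d v T \<in> squarefree_ideal (colon_edges x E)"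
    using colon u cycle unfolding koszul_reg_le_def by blast
  show "\<exists>w\<in>koszul_chains (Suc p) d. \<forall>T. z T - koszul_d w T \<in> squarefree_ideal E"
  proof (intro bexI allI)
    fix T
    have "z T = koszul_d w T + i T + Var x * u T"
      using yiu[of T] by (simp add: y_def diff_eq_eq add_ac)
    then have "z T - koszul_d (\<lambda>T. w T + Var x * v T) T = i T + Var x * (u T - koszul_d v T)"
      by (simp add: koszul_d_add koszul_d_mult right_diff_distrib)
    also have "\<dots> \<in> squarefree_ideal E"
      by (intro squarefree_ideal_add i) (simp add: Var_mult_squarefree_ideal_iff uv)
    finally show "z T - koszul_d (\<lambda>T. w T + Var x * v T) T \<in> squarefree_ideal E" .
  next
    have "(\<lambda>T. Var x * v T) \<in> koszul_chains (Suc p) d"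
    proof (rule koszul_chainsI)
      fix T :: "'v set" assume "card T \<noteq> Suc p"
      then show "Var x * v T = 0" by (simp add: koszul_chains_eq_0[OF v])
    next
      fix T :: "'v set"
      show "homogeneous (d - int (Suc p)) (Var x * v T)"
        using koszul_chains_homogeneous[OF v, of T]
        by (intro homogeneous_Var_mult) (simp add: algebra_simps)
    qed
    then show "(\<lambda>T. w T + Var x * v T) \<in> koszul_chains (Suc p) d"
      by (intro koszul_chains_add w)
  qed
qed

section \<open>Degrees in minimal resolutions\<close>
lemma module_mult: "Modules.module ((*) :: 'r::comm_ring_1 \<Rightarrow> 'r \<Rightarrow> 'r)"
  by unfold_locales (simp_all add: algebra_simps)

lemma ideal_gen_vars_lookup_0:
  fixes f :: "('v, 'k::comm_ring_1) mpoly"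
  assumes "f \<in> ideal_gen (range Var)"
  shows "Poly_Mapping.lookup f 0 = 0"
proof -
  interpret Modules.module "(*) :: ('v, 'k) mpoly \<Rightarrow> _" by (rule module_mult)
  have "subspace {f :: ('v, 'k) mpoly. Poly_Mapping.lookup f 0 = 0}"
    by (rule subspaceI) (simp_all add: lookup_add lookup_mult_0)
  moreover have "range Var \<subseteq> {f :: ('v, 'k) mpoly. Poly_Mapping.lookup f 0 = 0}"
  proof safe
    fix x :: 'v
    have "Poly_Mapping.single x (1::nat) \<noteq> 0"
      by (metis lookup_single_eq lookup_zero zero_neq_one)
    then show "Poly_Mapping.lookup (Var x :: ('v, 'k) mpoly) 0 = 0"
      by (simp add: Var_def lookup_single)
  qed
  ultimately have "span (range Var) \<subseteq> {f :: ('v, 'k) mpoly. Poly_Mapping.lookup f 0 = 0}"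
    by (rule span_minimal[rotated])
  then show ?thesis using assms by (auto simp: ideal_gen_def)
qed

definition koszul_d_vec ::
  "nat \<Rightarrow> ('v::finite set \<Rightarrow> ('v, 'k::comm_ring_1) mpoly vec) \<Rightarrow> 'v set \<Rightarrow> ('v, 'k) mpoly vec" where
  "koszul_d_vec N Z T = vec N (\<lambda>k. koszul_d (\<lambda>S. Z S $ k) T)"

lemma koszul_d_vec_carrier [simp]: "koszul_d_vec N Z T \<in> carrier_vec N"
  by (simp add: koszul_d_vec_def)

lemma dim_koszul_d_vec [simp]: "dim_vec (koszul_d_vec N Z T) = N"
  by (simp add: koszul_d_vec_def)

lemma koszul_d_vec_index [simp]: "k < N \<Longrightarrow> koszul_d_vec N Z T $ k = koszul_d (\<lambda>S. Z S $ k) T"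
  by (simp add: koszul_d_vec_def)

lemma koszul_d_cong: "(\<And>S. f S = g S) \<Longrightarrow> koszul_d f T = koszul_d g T"
  by (simp add: koszul_d_def)

lemma koszul_d_vec_diff:
  assumes "\<And>S. A S \<in> carrier_vec N" "\<And>S. B S \<in> carrier_vec N"
  shows "koszul_d_vec N (\<lambda>S. A S - B S) T = koszul_d_vec N A T - koszul_d_vec N B T"
proof (rule eq_vecI)
  fix k assume "k < dim_vec (koszul_d_vec N A T - koszul_d_vec N B T)"
  then have k: "k < N" by simp
  have "koszul_d (\<lambda>S. (A S - B S) $ k) T = koszul_d (\<lambda>S. A S $ k - B S $ k) T"
    using k carrier_vecD[OF assms(2)] by (intro koszul_d_cong) simp
  then show "koszul_d_vec N (\<lambda>S. A S - B S) T $ k = (koszul_d_vec N A T - koszul_d_vec N B T) $ k"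
    using k by (simp add: koszul_d_diff)
qed simp

lemma koszul_d_vec_koszul_d_vec [simp]: "koszul_d_vec N (koszul_d_vec N Z) T = 0\<^sub>v N"
proof (rule eq_vecI)
  fix k assume "k < dim_vec (0\<^sub>v N)"
  then have k: "k < N" by simp
  have "koszul_d (\<lambda>S. koszul_d_vec N Z S $ k) T = koszul_d (koszul_d (\<lambda>S. Z S $ k)) T"
    using k by (intro koszul_d_cong) simp
  then show "koszul_d_vec N (koszul_d_vec N Z) T $ k = 0\<^sub>v N $ k"
    using k by simp
qed simp

lemma koszul_d_scalar_prod:
  assumes "\<And>S. Z S \<in> carrier_vec N"
  shows "koszul_d (\<lambda>S. c \<bullet> Z S) T = c \<bullet> koszul_d_vec N Z T"
proof -
  have "koszul_d (\<lambda>S. c \<bullet> Z S) T = koszul_d (\<lambda>S. \<Sum>i\<in>{0..<N}. c $ i * Z S $ i) T"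
    using carrier_vecD[OF assms] by (intro koszul_d_cong) (simp add: scalar_prod_def)
  also have "\<dots> = (\<Sum>i\<in>{0..<N}. c $ i * koszul_d (\<lambda>S. Z S $ i) T)"
    by (simp add: koszul_d_sum koszul_d_mult)
  finally show ?thesis by (simp add: scalar_prod_def)
qed

lemma koszul_d_vec_mult:
  assumes "A \<in> carrier_mat N M" "\<And>S. Z S \<in> carrier_vec M"
  shows "koszul_d_vec N (\<lambda>S. A *\<^sub>v Z S) T = A *\<^sub>v koszul_d_vec M Z T"
proof (rule eq_vecI)
  fix k assume "k < dim_vec (A *\<^sub>v koszul_d_vec M Z T)"
  then have k: "k < N" using assms(1) by simp
  have "koszul_d (\<lambda>S. (A *\<^sub>v Z S) $ k) T = koszul_d (\<lambda>S. row A k \<bullet> Z S) T"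
    using k assms(1) by (intro koszul_d_cong) simp
  then show "koszul_d_vec N (\<lambda>S. A *\<^sub>v Z S) T $ k = (A *\<^sub>v koszul_d_vec M Z T) $ k"
    using k assms by (simp add: koszul_d_scalar_prod)
qed (use assms(1) in simp)

text \<open>
  Chains with values in a free module whose \<open>k\<close>-th basis element has degree \<open>a k\<close>, the whole chain
  having degree \<open>d\<close>.
\<close>
definition koszul_vec_chains ::
  "nat \<Rightarrow> (nat \<Rightarrow> int) \<Rightarrow> nat \<Rightarrow> int \<Rightarrow>
    ('v::finite set \<Rightarrow> ('v, 'k::comm_ring_1) mpoly vec) set" where
  "koszul_vec_chains N a p d =
    {Z. (\<forall>T. Z T \<in> carrier_vec N) \<and> (\<forall>k<N. (\<lambda>T. Z T $ k) \<in> koszul_chains p (d - a k))}"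

lemma koszul_vec_chains_carrier: "Z \<in> koszul_vec_chains N a p d \<Longrightarrow> Z T \<in> carrier_vec N"
  by (simp add: koszul_vec_chains_def)

lemma koszul_vec_chains_component:
  "Z \<in> koszul_vec_chains N a p d \<Longrightarrow> k < N \<Longrightarrow> (\<lambda>T. Z T $ k) \<in> koszul_chains p (d - a k)"
  by (simp add: koszul_vec_chains_def)

lemma koszul_chains_scalar_prod:
  assumes Z: "Z \<in> koszul_vec_chains N a p d"
    and c: "\<And>i. i < N \<Longrightarrow> homogeneous (a i - b) (c $ i)"
  shows "(\<lambda>T. c \<bullet> Z T) \<in> koszul_chains p (d - b)"
proof (rule koszul_chainsI)
  fix T :: "'a set" assume T: "card T \<noteq> p"
  have "Z T $ k = 0" if "k < N" for k
    using koszul_chains_eq_0[OF koszul_vec_chains_component[OF Z that] T] .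
  then show "c \<bullet> Z T = 0"
    using carrier_vecD[OF koszul_vec_chains_carrier[OF Z]] by (simp add: scalar_prod_def)
next
  fix T :: "'a set"
  have "homogeneous (d - b - int p) (c $ i * Z T $ i)" if "i < N" for i
  proof -
    have "homogeneous ((a i - b) + (d - a i - int p)) (c $ i * Z T $ i)"
      by (intro homogeneous_mult c that koszul_chains_homogeneous[OF koszul_vec_chains_component[OF Z]])
    then show ?thesis by (simp add: algebra_simps)
  qed
  then show "homogeneous (d - b - int p) (c \<bullet> Z T)"
    using carrier_vecD[OF koszul_vec_chains_carrier[OF Z]]
    unfolding scalar_prod_def by (intro homogeneous_sum) simp
qed

lemma koszul_vec_chains_mult:
  assumes Z: "Z \<in> koszul_vec_chains M b p d" and A: "A \<in> carrier_mat N M"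
    and hom: "\<And>k j. k < N \<Longrightarrow> j < M \<Longrightarrow> homogeneous (b j - a k) (A $$ (k, j))"
  shows "(\<lambda>T. A *\<^sub>v Z T) \<in> koszul_vec_chains N a p d"
  unfolding koszul_vec_chains_def
proof (intro CollectI conjI allI impI)
  fix k assume k: "k < N"
  have "(\<lambda>T. (A *\<^sub>v Z T) $ k) = (\<lambda>T. row A k \<bullet> Z T)"
    using k A by simp
  also have "\<dots> \<in> koszul_chains p (d - a k)"
    using k A by (intro koszul_chains_scalar_prod[OF Z]) (simp add: hom)
  finally show "(\<lambda>T. (A *\<^sub>v Z T) $ k) \<in> koszul_chains p (d - a k)" .
qed (use A in \<open>auto simp: mult_mat_vec_def\<close>)

lemma koszul_vec_exact:
  assumes Z: "Z \<in> koszul_vec_chains N a p d"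
    and cycle: "\<And>T. koszul_d_vec N Z T = 0\<^sub>v N"
    and const: "\<And>k. k < N \<Longrightarrow> Poly_Mapping.lookup (Z {} $ k) 0 = 0"
  shows "\<exists>W \<in> koszul_vec_chains N a (Suc p) d. \<forall>T. koszul_d_vec N W T = Z T"
proof -
  have "\<exists>w \<in> koszul_chains (Suc p) (d - a k). \<forall>T. koszul_d w T = Z T $ k" if k: "k < N" for k
  proof (rule koszul_exact[OF koszul_vec_chains_component[OF Z k] _ const[OF k]])
    fix T
    show "koszul_d (\<lambda>T. Z T $ k) T = 0"
      using arg_cong[OF cycle[of T], of "\<lambda>v. v $ k"] k by simp
  qed
  then obtain w where w: "\<And>k. k < N \<Longrightarrow> w k \<in> koszul_chains (Suc p) (d - a k)"
    "\<And>k T. k < N \<Longrightarrow> koszul_d (w k) T = Z T $ k"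
    by metis
  show ?thesis
  proof (intro bexI allI)
    show "koszul_d_vec N (\<lambda>T. vec N (\<lambda>k. w k T)) T = Z T" for T
      using w(2) carrier_vecD[OF koszul_vec_chains_carrier[OF Z]] by (intro eq_vecI) simp_all
    show "(\<lambda>T. vec N (\<lambda>k. w k T)) \<in> koszul_vec_chains N a (Suc p) d"
      using w(1) by (simp add: koszul_vec_chains_def)
  qed
qed

lemma koszul_d_mem_subspace:
  fixes I :: "('v::finite, 'k::comm_ring_1) mpoly set"
  assumes "Modules.module.subspace (*) I" "\<And>T. f T \<in> I"
  shows "koszul_d f T \<in> I"
proof -
  interpret Modules.module "(*) :: ('v, 'k) mpoly \<Rightarrow> _" by (rule module_mult)
  show ?thesis
    unfolding koszul_d_def by (intro subspace_sum subspace_scale assms)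
qed

lemma vec_eq_diff_add:
  fixes a :: "'r::ab_group_add vec"
  shows "a \<in> carrier_vec N \<Longrightarrow> b \<in> carrier_vec N \<Longrightarrow> a = (b + a) - b"
  by (intro eq_vecI) auto

text \<open>
  A diagram chase in the double complex formed by the Koszul complex and the resolution.  A chain
  \<open>Z\<close> over \<open>F\<^sub>s\<close> whose image over \<open>F\<^sub>s\<^sub>-\<^sub>1\<close> is a Koszul boundary is the sum of a Koszul
  boundary and an element of the image of \<open>F\<^sub>s\<^sub>+\<^sub>1\<close>.  The chase descends with \<open>s\<close>: a preimage
  \<open>Z'\<close> of that boundary satisfies the same hypothesis one step lower, because the Koszul complex of
  a free module is exact.  At \<open>s = 0\<close> the chain maps to a Koszul cycle of \<open>R/I\<close>, which bounds by
  the assumption on its degree: the descent keeps \<open>s + q\<close> constant, so this is the homological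
  degree of the cycle.
\<close>
lemma resolution_staircase:
  fixes I :: "('v::finite, 'k::field) mpoly set"
  assumes res: "graded_free_resolution I n a \<epsilon> D"
    and I: "Modules.module.subspace (*) I"
    and reg: "koszul_reg_le I r"
    and d: "d > int r + int (s + q)"
    and Z: "Z \<in> koszul_vec_chains (n s) (a s) q d"
    and base: "s = 0 \<Longrightarrow> (\<forall>T. koszul_d (\<lambda>S. \<epsilon> \<bullet> Z S) T \<in> I)"
    and step: "\<And>s'. s = Suc s' \<Longrightarrow>
      \<exists>Z' \<in> koszul_vec_chains (n s') (a s') (Suc q) d. \<forall>T. D s *\<^sub>v Z T = koszul_d_vec (n s') Z' T"
  shows "\<exists>Y Y'. (\<forall>T. Y T \<in> carrier_vec (n s)) \<and> (\<forall>T. Y' T \<in> carrier_vec (n (Suc s))) \<and>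
    (\<forall>T. Z T = koszul_d_vec (n s) Y T + D (Suc s) *\<^sub>v Y' T)"
  using d Z base step
proof (induction s arbitrary: q Z)
  case 0
  interpret Modules.module "(*) :: ('v, 'k) mpoly \<Rightarrow> _" by (rule module_mult)
  note Zc = koszul_vec_chains_carrier[OF 0(2)]
  have eps: "\<epsilon> \<in> carrier_vec (n 0)" "\<And>j. j < n 0 \<Longrightarrow> homogeneous (a 0 j) (\<epsilon> $ j)"
    and surj: "\<And>f. \<exists>c\<in>carrier_vec (n 0). f - \<epsilon> \<bullet> c \<in> I"
    and ker: "{c \<in> carrier_vec (n 0). \<epsilon> \<bullet> c \<in> I} = (\<lambda>c. D (Suc 0) *\<^sub>v c) ` carrier_vec (n (Suc 0))"
    using res unfolding graded_free_resolution_def by auto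
  have "(\<lambda>T. \<epsilon> \<bullet> Z T) \<in> koszul_chains q d"
    using koszul_chains_scalar_prod[OF 0(2), of 0 \<epsilon>] eps(2) by simp
  moreover have "\<forall>T. koszul_d (\<lambda>S. \<epsilon> \<bullet> Z S) T \<in> I" using 0(3) by simp
  ultimately obtain w where w: "\<And>T. \<epsilon> \<bullet> Z T - koszul_d w T \<in> I"
    using reg 0(1) unfolding koszul_reg_le_def by force
  have "\<exists>c\<in>carrier_vec (n 0). w T - \<epsilon> \<bullet> c \<in> I" for T by (rule surj)
  then obtain Y where Y: "\<And>T. Y T \<in> carrier_vec (n 0)" "\<And>T. w T - \<epsilon> \<bullet> Y T \<in> I"
    by metis
  have "\<exists>c\<in>carrier_vec (n (Suc 0)). Z T - koszul_d_vec (n 0) Y T = D (Suc 0) *\<^sub>v c" for T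
  proof -
    have "\<epsilon> \<bullet> (Z T - koszul_d_vec (n 0) Y T) = \<epsilon> \<bullet> Z T - koszul_d (\<lambda>S. \<epsilon> \<bullet> Y S) T"
      using eps(1) Zc by (simp add: scalar_prod_minus_distrib[of _ "n 0"] koszul_d_scalar_prod[OF Y(1)])
    also have "\<dots> = (\<epsilon> \<bullet> Z T - koszul_d w T) + koszul_d (\<lambda>S. w S - \<epsilon> \<bullet> Y S) T"
      by (simp add: koszul_d_diff)
    also have "\<dots> \<in> I"
      by (intro subspace_add[OF I] w koszul_d_mem_subspace[OF I] Y(2))
    finally have "Z T - koszul_d_vec (n 0) Y T \<in> {c \<in> carrier_vec (n 0). \<epsilon> \<bullet> c \<in> I}"
      using Zc by simp
    then show ?thesis unfolding ker by auto
  qed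
  then obtain Y' where Y': "\<And>T. Y' T \<in> carrier_vec (n (Suc 0))"
    "\<And>T. Z T - koszul_d_vec (n 0) Y T = D (Suc 0) *\<^sub>v Y' T"
    by metis
  have "Z T = koszul_d_vec (n 0) Y T + D (Suc 0) *\<^sub>v Y' T" for T
    using Zc[of T] unfolding Y'(2)[symmetric] by (intro eq_vecI) auto
  then show ?case using Y(1) Y'(1) by blast
next
  case (Suc s)
  interpret Modules.module "(*) :: ('v, 'k) mpoly \<Rightarrow> _" by (rule module_mult)
  have D: "\<And>i. D (Suc i) \<in> carrier_mat (n i) (n (Suc i))"
    "\<And>i k j. k < n i \<Longrightarrow> j < n (Suc i) \<Longrightarrow> homogeneous (a (Suc i) j - a i k) (D (Suc i) $$ (k, j))"
    and ker0: "{c \<in> carrier_vec (n 0). \<epsilon> \<bullet> c \<in> I} = (\<lambda>c. D (Suc 0) *\<^sub>v c) ` carrier_vec (n (Suc 0))"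
    and ker: "\<And>i. mat_kernel (D (Suc i)) = (\<lambda>c. D (Suc (Suc i)) *\<^sub>v c) ` carrier_vec (n (Suc (Suc i)))"
    using res unfolding graded_free_resolution_def by auto
  have DD: "D (Suc i) *\<^sub>v (D (Suc (Suc i)) *\<^sub>v c) = 0\<^sub>v (n i)"
    if "c \<in> carrier_vec (n (Suc (Suc i)))" for i c
  proof -
    have "D (Suc (Suc i)) *\<^sub>v c \<in> mat_kernel (D (Suc i))" using that by (simp add: ker)
    then show ?thesis using mat_kernelD(2)[OF D(1)] by blast
  qed
  note Zc = koszul_vec_chains_carrier[OF Suc.prems(2)]
  obtain Z' where Z': "Z' \<in> koszul_vec_chains (n s) (a s) (Suc q) d"
    and DZ: "\<And>T. D (Suc s) *\<^sub>v Z T = koszul_d_vec (n s) Z' T"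
    using Suc.prems(4)[of s] by auto
  note Z'c = koszul_vec_chains_carrier[OF Z']
  have "\<exists>Y Y'. (\<forall>T. Y T \<in> carrier_vec (n s)) \<and> (\<forall>T. Y' T \<in> carrier_vec (n (Suc s))) \<and>
    (\<forall>T. Z' T = koszul_d_vec (n s) Y T + D (Suc s) *\<^sub>v Y' T)"
  proof (rule Suc.IH[OF _ Z'])
    show "int r + int (s + Suc q) < d" using Suc.prems(1) by simp
    show "\<forall>T. koszul_d (\<lambda>S. \<epsilon> \<bullet> Z' S) T \<in> I" if "s = 0"
    proof
      fix T
      have "koszul_d_vec (n 0) Z' T \<in> (\<lambda>c. D (Suc 0) *\<^sub>v c) ` carrier_vec (n (Suc 0))"
        using DZ[of T] Zc[of T] that by (metis image_eqI)
      then show "koszul_d (\<lambda>S. \<epsilon> \<bullet> Z' S) T \<in> I"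
        using koszul_d_scalar_prod[of Z' "n 0" \<epsilon> T] Z'c that by (simp flip: ker0)
    qed
    show "\<exists>Z''\<in>koszul_vec_chains (n s') (a s') (Suc (Suc q)) d. \<forall>T. D s *\<^sub>v Z' T = koszul_d_vec (n s') Z'' T"
      if s: "s = Suc s'" for s'
    proof -
      have V: "(\<lambda>T. D s *\<^sub>v Z' T) \<in> koszul_vec_chains (n s') (a s') (Suc q) d"
        unfolding s by (intro koszul_vec_chains_mult[OF Z'[unfolded s]] D)
      have "\<exists>W\<in>koszul_vec_chains (n s') (a s') (Suc (Suc q)) d.
          \<forall>T. koszul_d_vec (n s') W T = D s *\<^sub>v Z' T"
      proof (rule koszul_vec_exact[OF V])
        fix T
        show "koszul_d_vec (n s') (\<lambda>T. D s *\<^sub>v Z' T) T = 0\<^sub>v (n s')"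
          using koszul_d_vec_mult[where T=T, OF D(1)[of s'] Z'c[unfolded s]] DZ[of T] DD[OF Zc[of T, unfolded s]]
          by (simp add: s)
      next
        fix k assume "k < n s'"
        then show "Poly_Mapping.lookup ((D s *\<^sub>v Z' {}) $ k) 0 = 0"
          using koszul_chains_eq_0[OF koszul_vec_chains_component[OF V], of k "{}"] by simp
      qed
      then show ?thesis by metis
    qed
  qed
  then obtain Y Y' where Y: "\<And>T. Y T \<in> carrier_vec (n s)"
    and Y': "\<And>T. Y' T \<in> carrier_vec (n (Suc s))"
    and Z'eq: "\<And>T. Z' T = koszul_d_vec (n s) Y T + D (Suc s) *\<^sub>v Y' T"
    by blast
  have "\<exists>c\<in>carrier_vec (n (Suc (Suc s))). Z T - koszul_d_vec (n (Suc s)) Y' T = D (Suc (Suc s)) *\<^sub>v c"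
    for T
  proof -
    have "D (Suc s) *\<^sub>v (Z T - koszul_d_vec (n (Suc s)) Y' T) =
        koszul_d_vec (n s) Z' T - koszul_d_vec (n s) (\<lambda>S. D (Suc s) *\<^sub>v Y' S) T"
      using Zc[of T] by (simp add: mult_minus_distrib_mat_vec[OF D(1)] DZ koszul_d_vec_mult[OF D(1) Y'])
    also have "(\<lambda>S. D (Suc s) *\<^sub>v Y' S) = (\<lambda>S. Z' S - koszul_d_vec (n s) Y S)"
    proof
      fix S
      have "D (Suc s) *\<^sub>v Y' S \<in> carrier_vec (n s)" using D(1) Y' by (metis mult_mat_vec_carrier)
      then show "D (Suc s) *\<^sub>v Y' S = Z' S - koszul_d_vec (n s) Y S"
        unfolding Z'eq[of S] by (intro vec_eq_diff_add) auto
    qed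
    also have "koszul_d_vec (n s) Z' T - koszul_d_vec (n s) (\<lambda>S. Z' S - koszul_d_vec (n s) Y S) T = 0\<^sub>v (n s)"
      by (subst koszul_d_vec_diff[OF Z'c]) (auto intro!: eq_vecI)
    finally have "Z T - koszul_d_vec (n (Suc s)) Y' T \<in> mat_kernel (D (Suc s))"
      using Zc[of T] by (intro mat_kernelI[OF D(1)]) auto
    then show ?thesis unfolding ker by auto
  qed
  then obtain Y'' where Y'': "\<And>T. Y'' T \<in> carrier_vec (n (Suc (Suc s)))"
    "\<And>T. Z T - koszul_d_vec (n (Suc s)) Y' T = D (Suc (Suc s)) *\<^sub>v Y'' T"
    by metis
  have "Z T = koszul_d_vec (n (Suc s)) Y' T + D (Suc (Suc s)) *\<^sub>v Y'' T" for T
    using Zc[of T] unfolding Y''(2)[symmetric] by (intro eq_vecI) auto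
  then show ?case using Y' Y''(1) by blast
qed

text \<open>
  The chase is applied to a basis element of \<open>F\<^sub>i\<close>.  Minimality enters twice: the image of the
  basis element in \<open>F\<^sub>i\<^sub>-\<^sub>1\<close> has no constant coefficients and is therefore a Koszul boundary, and
  the decomposition obtained at the end consists of elements without constant coefficients, whereas
  the basis element has the coefficient 1.
\<close>
lemma minimal_resolution_degree_le:
  fixes I :: "('v::finite, 'k::field) mpoly set"
  assumes res: "minimal_graded_free_resolution I n a \<epsilon> D"
    and I: "Modules.module.subspace (*) I"
    and reg: "koszul_reg_le I r"
    and j: "j < n i"
  shows "a i j \<le> int r + int i"
proof (rule ccontr)
  assume "\<not> a i j \<le> int r + int i"
  then have d: "int r + int (i + 0) < a i j" by simp
  have gfr: "graded_free_resolution I n a \<epsilon> D"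
    and min: "\<And>s k l. k < n s \<Longrightarrow> l < n (Suc s) \<Longrightarrow> Poly_Mapping.lookup (D (Suc s) $$ (k, l)) 0 = 0"
    using res ideal_gen_vars_lookup_0 unfolding minimal_graded_free_resolution_def by auto
  have D: "\<And>i. D (Suc i) \<in> carrier_mat (n i) (n (Suc i))"
    "\<And>i k j. k < n i \<Longrightarrow> j < n (Suc i) \<Longrightarrow> homogeneous (a (Suc i) j - a i k) (D (Suc i) $$ (k, j))"
    using gfr unfolding graded_free_resolution_def by auto
  define Z :: "'v set \<Rightarrow> ('v, 'k) mpoly vec"
    where "Z T = (if T = {} then unit_vec (n i) j else 0\<^sub>v (n i))" for T
  have Z: "Z \<in> koszul_vec_chains (n i) (a i) 0 (a i j)"
    by (auto simp: koszul_vec_chains_def Z_def homogeneous_def monom_degree_def unit_vec_def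
        intro!: koszul_chainsI)
  have "\<exists>Y Y'. (\<forall>T. Y T \<in> carrier_vec (n i)) \<and> (\<forall>T. Y' T \<in> carrier_vec (n (Suc i))) \<and>
    (\<forall>T. Z T = koszul_d_vec (n i) Y T + D (Suc i) *\<^sub>v Y' T)"
  proof (rule resolution_staircase[OF gfr I reg d Z])
    interpret Modules.module "(*) :: ('v, 'k) mpoly \<Rightarrow> _" by (rule module_mult)
    assume i: "i = 0"
    have "\<epsilon> \<in> carrier_vec (n 0)" using gfr unfolding graded_free_resolution_def by auto
    then have "koszul_d (\<lambda>S. \<epsilon> \<bullet> Z S) T = 0" for T
      by (simp add: koszul_d_def Z_def i)
    then show "\<forall>T. koszul_d (\<lambda>S. \<epsilon> \<bullet> Z S) T \<in> I"
      using subspace_0[OF I] by simp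
  next
    fix s assume i: "i = Suc s"
    have V: "(\<lambda>T. D i *\<^sub>v Z T) \<in> koszul_vec_chains (n s) (a s) 0 (a i j)"
      unfolding i by (intro koszul_vec_chains_mult[OF Z[unfolded i]] D)
    have 0: "Z T = 0\<^sub>v (n i)" if "T \<noteq> {}" for T using that by (simp add: Z_def)
    have "\<exists>W\<in>koszul_vec_chains (n s) (a s) (Suc 0) (a i j).
        \<forall>T. koszul_d_vec (n s) W T = D i *\<^sub>v Z T"
    proof (rule koszul_vec_exact[OF V])
      fix T
      show "koszul_d_vec (n s) (\<lambda>T. D i *\<^sub>v Z T) T = 0\<^sub>v (n s)"
        using D(1)[of s] by (intro eq_vecI) (auto simp: koszul_d_def 0 i)
    next
      fix k assume k: "k < n s"
      have "(D i *\<^sub>v Z {}) $ k = D i $$ (k, j)"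
        using k D(1)[of s] j by (simp add: Z_def i)
      then show "Poly_Mapping.lookup ((D i *\<^sub>v Z {}) $ k) 0 = 0"
        using min[of k s j] k j by (simp add: i)
    qed
    then show "\<exists>Z'\<in>koszul_vec_chains (n s) (a s) (Suc 0) (a i j).
        \<forall>T. D i *\<^sub>v Z T = koszul_d_vec (n s) Z' T"
      by metis
  qed
  then obtain Y Y' where Y': "\<And>T. Y' T \<in> carrier_vec (n (Suc i))"
    and eq: "\<And>T. Z T = koszul_d_vec (n i) Y T + D (Suc i) *\<^sub>v Y' T"
    by blast
  have "1 = koszul_d (\<lambda>S. Y S $ j) {} + (\<Sum>l\<in>{0..<n (Suc i)}. Y' {} $ l * D (Suc i) $$ (j, l))"
    using arg_cong[OF eq[of "{}"], of "\<lambda>v. v $ j"] j D(1)[of i] carrier_vecD[OF Y'[of "{}"]]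
    by (simp add: Z_def scalar_prod_def mult.commute)
  from arg_cong[OF this, of "\<lambda>f. Poly_Mapping.lookup f 0"]
  have "(1 :: 'k) = 0"
    using j by (simp add: lookup_add lookup_sum lookup_mult_0 min)
  then show False by simp
qed

theorem reg_quotient_le:
  fixes I :: "('v::finite, 'k::field) mpoly set"
  assumes "Modules.module.subspace (*) I" and "koszul_reg_le I r"
  shows "reg_quotient I \<le> ereal (of_int (int r))"
  unfolding reg_quotient_def
proof (rule Sup_least, safe)
  fix n a \<epsilon> D i j
  assume "minimal_graded_free_resolution I n a \<epsilon> D" "j < n i"
  from minimal_resolution_degree_le[of I n a \<epsilon> D r j i, OF this(1) assms this(2)]
  show "ereal (real_of_int (a i j - int i)) \<le> ereal (real_of_int (int r))" by simp
qed

section \<open>Path ideals of leveled trees\<close>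
lemma koszul_reg_le_mono: "koszul_reg_le I r \<Longrightarrow> r \<le> s \<Longrightarrow> koszul_reg_le I s"
  unfolding koszul_reg_le_def by fastforce

text \<open>
  The generators are indexed because different ones may coincide after a splitting.  Splitting along
  a variable of a generator with at least two variables makes the sum strictly smaller on both sides:
  in \<open>I : x\<close> that generator loses a variable, and in \<open>I + (x)\<close> every generator divisible by
  \<open>x\<close> may be replaced by \<open>x\<close>.
\<close>
lemma koszul_reg_le_sum_card:
  fixes f :: "'a \<Rightarrow> 'v::finite set"
  assumes "finite A"
  shows "koszul_reg_le (squarefree_ideal (f ` A) :: ('v, 'k::comm_ring_1) mpoly set)
    (\<Sum>a\<in>A. card (f a) - 1)"
proof (induction "\<Sum>a\<in>A. card (f a) - 1" arbitrary: f rule: less_induct)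
  case less
  show ?case
  proof (cases "\<forall>a\<in>A. card (f a) \<le> 1")
    case True
    then show ?thesis by (intro koszul_reg_le_variables) auto
  next
    case False
    then obtain a where a: "a \<in> A" "2 \<le> card (f a)" by auto
    then obtain x where x: "x \<in> f a" by (metis all_not_in_conv card.empty not_numeral_le_zero)
    have drop: "(\<Sum>b\<in>A. card (g b) - 1) < (\<Sum>b\<in>A. card (f b) - 1)"
      if "\<And>b. card (g b) \<le> card (f b)" "card (g a) < card (f a)" for g :: "'a \<Rightarrow> 'v set"
      using that a by (intro sum_strict_mono_ex1 assms)
        (auto simp: diff_le_mono intro!: bexI[of _ a])
    \<comment> \<open>The families generating \<open>I : x\<close> and \<open>I + (x)\<close>, indexed by the same set \<open>A\<close>.\<close>
    define g where "g b = f b - {x}" for b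
    define g' where "g' b = (if x \<in> f b then {x} else f b)" for b
    have lt: "(\<Sum>b\<in>A. card (g b) - 1) < (\<Sum>b\<in>A. card (f b) - 1)"
      using x a(2) by (intro drop) (auto simp: g_def intro!: card_mono)
    have lt': "(\<Sum>b\<in>A. card (g' b) - 1) < (\<Sum>b\<in>A. card (f b) - 1)"
      using x a(2) by (intro drop) (auto simp: g'_def Suc_le_eq card_gt_0_iff)
    obtain r where r: "(\<Sum>b\<in>A. card (f b) - 1) = Suc r"
      using lt by (cases "\<Sum>b\<in>A. card (f b) - 1") auto
    have "colon_edges x (f ` A) = g ` A"
      by (auto simp: colon_edges_def g_def)
    then have 1: "koszul_reg_le (squarefree_ideal (colon_edges x (f ` A)) :: ('v, 'k) mpoly set) r"
      using koszul_reg_le_mono[OF less.hyps[OF lt]] lt r by simp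
    have "kill_edges x (f ` A) = g' ` A"
      using x a(1) by (auto simp: kill_edges_def g'_def image_iff)
    then have 2: "koszul_reg_le (squarefree_ideal (kill_edges x (f ` A)) :: ('v, 'k) mpoly set) (Suc r)"
      using koszul_reg_le_mono[OF less.hyps[OF lt']] lt' r by simp
    show ?thesis unfolding r by (rule koszul_reg_le_split[OF 1 2])
  qed
qed

text \<open>
  All that the argument uses of a rooted tree: a parent function lowering a level function by one.
  At level 0 the value of \<open>par\<close> is arbitrary, so the definitions below guard it by the level.
\<close>
locale leveled_tree =
  fixes par :: "'v::finite \<Rightarrow> 'v" and lv :: "'v \<Rightarrow> nat" and h t :: nat
  assumes lv_par: "0 < lv v \<Longrightarrow> lv (par v) = lv v - 1"
    and lv_le: "lv v \<le> h"
    and t_bounds: "1 \<le> t" "h + 1 \<le> 2 * t" "t \<le> h + 1"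
begin

definition path_to :: "'v \<Rightarrow> 'v set" where
  "path_to v = (\<lambda>i. (par ^^ i) v) ` {..<t}"

text \<open>
  A path starts at level at most \<open>h + 1 - t\<close> and hence contains all the ancestors in \<open>band\<close>
  of its last vertex.
\<close>
definition band :: "'v set" where
  "band = {v. h + 1 - t \<le> lv v \<and> lv v < h}"

text \<open>
  The descendants of \<open>x\<close>, including \<open>x\<close>.
\<close>
definition below :: "'v \<Rightarrow> 'v set" where
  "below x = {v. \<exists>i\<le>lv v. (par ^^ i) v = x}"

definition tips :: "'v set \<Rightarrow> 'v set" where
  "tips L = {v \<in> L. t - 1 \<le> lv v \<and> (\<forall>u\<in>L. 0 < lv u \<longrightarrow> par u \<noteq> v)}"

text \<open>
  The state of the splitting process.  The variables in \<open>C\<close> have been divided out, those in \<open>S\<close>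
  have been added to the ideal, and \<open>L\<close> consists of the vertices without an ancestor in \<open>S\<close>
  (each vertex being its own ancestor), so that the paths ending in \<open>L\<close> are those that still count.
\<close>
definition residual_edges :: "'v set \<Rightarrow> 'v set \<Rightarrow> 'v set \<Rightarrow> 'v set set" where
  "residual_edges L C S = (\<lambda>v. path_to v - C) ` {v \<in> L. t - 1 \<le> lv v} \<union> (\<lambda>s. {s}) ` S"

text \<open>
  An unprocessed vertex of \<open>band\<close> costs at most 1, by being divided out.  The second sum is what
  remains to be paid when there are no such vertices left, see \<open>reg_le_base\<close>.
\<close>
definition potential :: "'v set \<Rightarrow> 'v set \<Rightarrow> nat" where
  "potential L C = card (band \<inter> L - C) + (\<Sum>v\<in>tips L. h - lv v - 1)"

definition ancestor_closed :: "'v set \<Rightarrow> bool" where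
  "ancestor_closed L \<longleftrightarrow> (\<forall>v\<in>L. 0 < lv v \<longrightarrow> par v \<in> L)"

lemma lv_funpow_par: "i \<le> lv v \<Longrightarrow> lv ((par ^^ i) v) = lv v - i"
  by (induction i) (auto simp: lv_par)

lemma ancestor_closed_funpow: "ancestor_closed L \<Longrightarrow> v \<in> L \<Longrightarrow> i \<le> lv v \<Longrightarrow> (par ^^ i) v \<in> L"
  by (induction i) (auto simp: ancestor_closed_def lv_funpow_par)

lemma mem_path_to_iff_below:
  assumes "x \<in> band" "t - 1 \<le> lv v"
  shows "x \<in> path_to v \<longleftrightarrow> v \<in> below x"
proof
  assume "x \<in> path_to v"
  then obtain i where "i < t" "x = (par ^^ i) v" by (auto simp: path_to_def)
  then show "v \<in> below x"
    using assms(2) t_bounds by (auto simp: below_def intro!: exI[of _ i])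
next
  assume "v \<in> below x"
  then obtain i where i: "i \<le> lv v" "(par ^^ i) v = x" by (auto simp: below_def)
  then have "lv x = lv v - i" using lv_funpow_par by auto
  then have "i < t"
    using assms(1) i lv_le[of v] t_bounds by (auto simp: band_def)
  then show "x \<in> path_to v" using i by (auto simp: path_to_def)
qed

lemma colon_residual_edges:
  "x \<notin> S \<Longrightarrow> colon_edges x (residual_edges L C S) = residual_edges L (insert x C) S"
  unfolding colon_edges_def residual_edges_def image_Un image_image
  by (intro arg_cong2[of _ _ _ _ "(\<union>)"] image_cong) auto

lemma kill_residual_edges:
  assumes "x \<in> band" "x \<notin> C" "x \<notin> S"
  shows "kill_edges x (residual_edges L C S) = residual_edges (L - below x) C (insert x S)"
proof -
  have "{e \<in> residual_edges L C S. x \<notin> e} =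
      (\<lambda>v. path_to v - C) ` {v \<in> L - below x. t - 1 \<le> lv v} \<union> (\<lambda>s. {s}) ` S"
    using assms mem_path_to_iff_below by (auto simp: residual_edges_def)
  then show ?thesis by (auto simp: kill_edges_def residual_edges_def)
qed

text \<open>
  Once \<open>band\<close> has been divided out, a path ending at a level \<open>l < h\<close> retains at most its vertices of
  levels \<open>l + 1 - t\<close> to \<open>h - t\<close>, and a path ending at level \<open>h\<close> at most its last vertex.
\<close>
lemma card_path_to_diff_le:
  assumes "ancestor_closed L" "band \<inter> L \<subseteq> C" "v \<in> L" "t - 1 \<le> lv v"
  shows "card (path_to v - C) - 1 \<le> h - lv v - 1"
proof (cases "lv v = h")
  case True
  have "path_to v - C \<subseteq> {v}"
  proof
    fix y assume "y \<in> path_to v - C"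
    then obtain i where i: "i < t" "y = (par ^^ i) v" "y \<notin> C" by (auto simp: path_to_def)
    then have "y \<in> L" "lv y = h - i"
      using assms lv_funpow_par[of i v] ancestor_closed_funpow[of L v i] True by auto
    moreover have "y \<in> band" if "i \<noteq> 0"
      using that \<open>lv y = h - i\<close> i(1) assms(4) True by (auto simp: band_def)
    ultimately have "i = 0"
      using i(3) assms(2) by blast
    then show "y \<in> {v}" using i by simp
  qed
  then show ?thesis using card_mono[of "{v}"] by fastforce
next
  case False
  then have lt: "lv v < h" using lv_le[of v] by simp
  have "path_to v - C \<subseteq> (\<lambda>i. (par ^^ i) v) ` {lv v + t - h..<t}"
  proof
    fix y assume "y \<in> path_to v - C"
    then obtain i where i: "i < t" "y = (par ^^ i) v" "y \<notin> C" by (auto simp: path_to_def)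
    then have "y \<in> L" "lv y = lv v - i"
      using assms lv_funpow_par[of i v] ancestor_closed_funpow[of L v i] by auto
    moreover from this have "y \<notin> band"
      using i(3) assms(2) by blast
    ultimately have "lv v - i < h + 1 - t"
      using lt unfolding band_def by auto
    then have "i \<in> {lv v + t - h..<t}"
      using i(1) assms(4) t_bounds by auto
    then show "y \<in> (\<lambda>i. (par ^^ i) v) ` {lv v + t - h..<t}" using i(2) by blast
  qed
  then have "card (path_to v - C) \<le> card ((\<lambda>i. (par ^^ i) v) ` {lv v + t - h..<t})"
    by (intro card_mono) auto
  also have "\<dots> \<le> card {lv v + t - h..<t}" by (intro card_image_le) simp
  also have "\<dots> \<le> h - lv v" using lt assms(4) t_bounds by simp
  finally show ?thesis by simp
qed

lemma path_to_child: "0 < lv u \<Longrightarrow> path_to u \<subseteq> insert u (path_to (par u))"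
proof
  fix y assume "y \<in> path_to u"
  then obtain i where "i < t" "y = (par ^^ i) u" by (auto simp: path_to_def)
  then show "y \<in> insert u (path_to (par u))"
    by (cases i) (auto simp: path_to_def funpow_swap1)
qed

text \<open>
  The path ending in a child \<open>u\<close> of \<open>v\<close> is contained in \<open>u\<close> together with the path ending in
  \<open>v\<close>.  If \<open>u\<close> has been divided out, this makes the generator of \<open>v\<close> redundant.  At levels
  less than \<open>h - 1\<close> only the generators of vertices without a child in \<open>L\<close> are therefore needed,
  and those of levels \<open>h - 1\<close> and \<open>h\<close> have degree at most 1 and contribute nothing.
\<close>
lemma reg_le_base:
  assumes L: "ancestor_closed L" and C: "band \<inter> L \<subseteq> C"
  shows "koszul_reg_le (squarefree_ideal (residual_edges L C S) :: ('v, 'k::comm_ring_1) mpoly set)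
    (\<Sum>v\<in>tips L. h - lv v - 1)"
proof -
  \<comment> \<open>The vertices whose paths suffice to generate the ideal; the summand \<open>S\<close> of the index set
    accounts for the variables that have been added.\<close>
  define T where "T = {v \<in> L. t - 1 \<le> lv v \<and> (v \<in> tips L \<or> h - 1 \<le> lv v)}"
  define f where "f = case_sum (\<lambda>v. path_to v - C) (\<lambda>s. {s})"
  have dom: "\<exists>u\<in>T. path_to u - C \<subseteq> path_to v - C" if "v \<in> L" "t - 1 \<le> lv v" for v
    using that
  proof (induction "h - lv v" arbitrary: v rule: less_induct)
    case less
    show ?case
    proof (cases "v \<in> T")
      case False
      then obtain u where u: "u \<in> L" "0 < lv u" "par u = v" and v: "lv v < h - 1"
        using less.prems by (auto simp: T_def tips_def)
      then have lu: "lv u = Suc (lv v)" using lv_par[of u] by simp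
      then have "u \<in> C"
        using u v C less.prems t_bounds by (auto simp: band_def)
      then have "path_to u - C \<subseteq> path_to v - C"
        using path_to_child[OF u(2)] u(3) by auto
      moreover have "\<exists>w\<in>T. path_to w - C \<subseteq> path_to u - C"
        using u lu v less.prems by (intro less.hyps) auto
      ultimately show ?thesis by blast
    qed blast
  qed
  have "squarefree_ideal (residual_edges L C S) = (squarefree_ideal (f ` (T <+> S)) :: ('v, 'k) mpoly set)"
  proof (intro equalityI squarefree_ideal_mono)
    fix e assume "e \<in> residual_edges L C S"
    then consider v where "v \<in> L" "t - 1 \<le> lv v" "e = path_to v - C" | s where "s \<in> S" "e = {s}"
      by (auto simp: residual_edges_def)
    then show "\<exists>e'\<in>f ` (T <+> S). e' \<subseteq> e"
    proof cases
      case 1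
      then obtain u where "u \<in> T" "path_to u - C \<subseteq> e" using dom by blast
      then have "f (Inl u) \<in> f ` (T <+> S)" "f (Inl u) \<subseteq> e"
        by (intro imageI InlI, simp, simp add: f_def)
      then show ?thesis by blast
    next
      case 2
      then have "f (Inr s) \<in> f ` (T <+> S)" "f (Inr s) \<subseteq> e"
        by (intro imageI InrI, simp, simp add: f_def)
      then show ?thesis by blast
    qed
  next
    fix e assume "e \<in> f ` (T <+> S)"
    then have "e \<in> residual_edges L C S" by (auto simp: f_def residual_edges_def T_def)
    then show "\<exists>e'\<in>residual_edges L C S. e' \<subseteq> e" by blast
  qed
  moreover have "(\<Sum>a\<in>T <+> S. card (f a) - 1) \<le> (\<Sum>v\<in>tips L. h - lv v - 1)"
  proof -
    have "(\<Sum>a\<in>T <+> S. card (f a) - 1) = (\<Sum>v\<in>T. card (path_to v - C) - 1)"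
      by (subst sum.Plus) (auto simp: f_def)
    also have "\<dots> \<le> (\<Sum>v\<in>T. h - lv v - 1)"
      by (intro sum_mono card_path_to_diff_le[OF L C]) (auto simp: T_def)
    also have "\<dots> = (\<Sum>v\<in>tips L. h - lv v - 1)"
      by (intro sum.mono_neutral_right) (auto simp: T_def tips_def)
    finally show ?thesis .
  qed
  ultimately show ?thesis
    using koszul_reg_le_mono[OF koszul_reg_le_sum_card[of "T <+> S" f, where 'k='k]] by simp
qed

lemma ancestor_closed_diff_below:
  assumes "ancestor_closed L"
  shows "ancestor_closed (L - below x)"
proof -
  have "par v \<notin> below x" if "v \<notin> below x" "0 < lv v" for v
  proof
    assume "par v \<in> below x"
    then obtain i where "i \<le> lv (par v)" "(par ^^ i) (par v) = x" by (auto simp: below_def)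
    then have "Suc i \<le> lv v" "(par ^^ Suc i) v = x"
      using lv_par[OF that(2)] that(2) by (auto simp: funpow_swap1)
    then show False using that(1) unfolding below_def by blast
  qed
  then show ?thesis using assms by (auto simp: ancestor_closed_def)
qed

text \<open>
  Removing a subtree can create one new childless vertex only, the parent of its root.
\<close>
lemma tips_diff_below:
  "tips (L - below x) \<subseteq> (tips L - below x) \<union> (if t \<le> lv x then {par x} else {})"
proof
  fix v assume v: "v \<in> tips (L - below x)"
  then have v': "v \<in> L" "v \<notin> below x" "t - 1 \<le> lv v" by (auto simp: tips_def)
  show "v \<in> (tips L - below x) \<union> (if t \<le> lv x then {par x} else {})"
  proof (cases "v \<in> tips L")
    case False
    then obtain u where u: "u \<in> L" "0 < lv u" "par u = v"
      using v' by (auto simp: tips_def)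
    then have "u \<in> below x" using v by (auto simp: tips_def)
    then obtain i where i: "i \<le> lv u" "(par ^^ i) u = x" by (auto simp: below_def)
    have "i = 0"
    proof (rule ccontr)
      assume "i \<noteq> 0"
      then obtain k where k: "i = Suc k" by (cases i) auto
      then have "(par ^^ k) v = x" "k \<le> lv v"
        using i u lv_par[of u] by (auto simp: funpow_swap1)
      then show False using v'(2) by (auto simp: below_def)
    qed
    then show ?thesis using i u v' lv_par[of u] by auto
  qed (use v' in simp)
qed

text \<open>
  The chain from \<open>x\<close> down to a deepest vertex \<open>w\<close> below it consists of unprocessed vertices, as
  processing goes from the root downwards.  Together with the amount that \<open>w\<close> contributes as a
  childless vertex they account for all the levels from \<open>lv x\<close> to \<open>h - 1\<close>.
\<close>
lemma kill_gain:
  assumes L: "ancestor_closed L" and x: "x \<in> band \<inter> L - C"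
    and C: "\<And>v. v \<in> C \<Longrightarrow> 0 < lv v \<Longrightarrow> par v \<in> band \<Longrightarrow> par v \<in> C" and tx: "t \<le> lv x"
  shows "h - lv x \<le> card ((band \<inter> L - C) \<inter> below x) + (\<Sum>v\<in>tips L \<inter> below x. h - lv v - 1)"
proof -
  have "x \<in> L \<inter> below x" using x by (auto simp: below_def intro: exI[of _ 0])
  then have "Max (lv ` (L \<inter> below x)) \<in> lv ` (L \<inter> below x)" by (intro Max_in) auto
  then obtain w where w: "w \<in> L" "w \<in> below x" "Max (lv ` (L \<inter> below x)) = lv w" by auto
  have max: "lv u \<le> lv w" if "u \<in> L \<inter> below x" for u
    using that unfolding w(3)[symmetric] by (intro Max_ge) auto
  obtain i where i: "i \<le> lv w" "(par ^^ i) w = x" using w(2) by (auto simp: below_def)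
  then have lx: "lv x = lv w - i" using lv_funpow_par by auto
  have "w \<in> tips L"
  proof -
    have "par u \<noteq> w" if "u \<in> L" "0 < lv u" for u
    proof
      assume u: "par u = w"
      then have "Suc i \<le> lv u" "(par ^^ Suc i) u = x"
        using i lv_par[OF that(2)] that(2) by (auto simp: funpow_swap1)
      then have "u \<in> below x" unfolding below_def by blast
      then show False using max[of u] that u lv_par[of u] by auto
    qed
    then show ?thesis using w lx tx by (auto simp: tips_def)
  qed
  then have 1: "h - lv w - 1 \<le> (\<Sum>v\<in>tips L \<inter> below x. h - lv v - 1)"
    using w(2) by (intro member_le_sum) auto
  \<comment> \<open>\<open>g l\<close> is the ancestor of \<open>w\<close> at level \<open>l\<close>.\<close>
  define g where "g l = (par ^^ (lv w - l)) w" for l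
  have g: "lv (g l) = l" if "l \<le> lv w" for l
    using that by (simp add: g_def lv_funpow_par)
  have gx: "(par ^^ (l - lv x)) (g l) = x" if "lv x \<le> l" "l \<le> lv w" for l
  proof -
    have "(par ^^ (l - lv x)) (g l) = (par ^^ (l - lv x + (lv w - l))) w"
      by (simp add: g_def funpow_add)
    also have "l - lv x + (lv w - l) = i" using that lx i by simp
    finally show ?thesis using i by simp
  qed
  have "g ` {lv x..<min h (Suc (lv w))} \<subseteq> (band \<inter> L - C) \<inter> below x"
  proof (rule image_subsetI)
    fix l assume "l \<in> {lv x..<min h (Suc (lv w))}"
    then have l: "lv x \<le> l" "l < h" "l \<le> lv w" by auto
    have bandx: "h + 1 - t \<le> lv x" using x by (auto simp: band_def)
    have "g l \<in> L" unfolding g_def by (intro ancestor_closed_funpow L w) simp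
    moreover have "g l \<in> band" using l bandx g by (simp add: band_def)
    moreover have "l - lv x \<le> lv (g l)" using g l by simp
    then have "g l \<in> below x" using gx[OF l(1,3)] unfolding below_def by blast
    moreover have "g l \<notin> C"
    proof
      assume gC: "g l \<in> C"
      have "(par ^^ k) (g l) \<in> C" if "k \<le> l - lv x" for k
        using that
      proof (induction k)
        case (Suc k)
        have "lv ((par ^^ k) (g l)) = l - k"
          using Suc.prems g l by (simp add: lv_funpow_par)
        moreover have "lv ((par ^^ Suc k) (g l)) = l - Suc k"
          using Suc.prems g l by (subst lv_funpow_par) auto
        then have "par ((par ^^ k) (g l)) \<in> band"
          using Suc.prems l bandx by (auto simp: band_def)
        ultimately show ?case
          using C[of "(par ^^ k) (g l)"] Suc by simp
      qed (use gC in simp)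
      from this[of "l - lv x"] show False using gx[OF l(1,3)] x by simp
    qed
    ultimately show "g l \<in> (band \<inter> L - C) \<inter> below x" by blast
  qed
  then have "card (g ` {lv x..<min h (Suc (lv w))}) \<le> card ((band \<inter> L - C) \<inter> below x)"
    by (intro card_mono) auto
  moreover have "inj_on g {lv x..<min h (Suc (lv w))}"
    by (rule inj_on_inverseI[of _ lv]) (simp add: g)
  ultimately have 2: "min h (Suc (lv w)) - lv x \<le> card ((band \<inter> L - C) \<inter> below x)"
    by (simp add: card_image)
  show ?thesis using 1 2 lx lv_le[of w] by linarith
qed

text \<open>
  Adding \<open>x\<close> to the ideal may turn its parent into a childless vertex, which costs
  \<open>h - lv x\<close>; the removed subtree is worth at least as much.
\<close>
lemma potential_diff_below:
  assumes L: "ancestor_closed L" and x: "x \<in> band \<inter> L - C"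
    and C: "\<And>v. v \<in> C \<Longrightarrow> 0 < lv v \<Longrightarrow> par v \<in> band \<Longrightarrow> par v \<in> C"
  shows "potential (L - below x) C \<le> potential L C"
proof -
  let ?U = "band \<inter> L - C" and ?b = "\<lambda>v. h - lv v - 1"
  define P where "P = (if t \<le> lv x then {par x} else {})"
  have "sum ?b (tips (L - below x)) \<le> sum ?b ((tips L - below x) \<union> P)"
    unfolding P_def by (intro sum_mono2 tips_diff_below) auto
  also have "\<dots> \<le> sum ?b (tips L - below x) + sum ?b P"
    by (simp add: sum_Un_nat)
  finally have 1: "sum ?b (tips (L - below x)) \<le> sum ?b (tips L - below x) + sum ?b P" .
  have "sum ?b P \<le> card (?U \<inter> below x) + sum ?b (tips L \<inter> below x)"
    using kill_gain[OF L x C] lv_par[of x] t_bounds by (auto simp: P_def)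
  moreover have "sum ?b (tips L) = sum ?b (tips L \<inter> below x) + sum ?b (tips L - below x)"
    by (rule sum.Int_Diff) simp
  moreover have "card ?U = card (?U \<inter> below x) + card (band \<inter> (L - below x) - C)"
    using sum.Int_Diff[of ?U "\<lambda>_. 1 :: nat" "below x"]
    by (simp add: Int_Diff Diff_Diff_Int Diff_Int_distrib Diff_eq Int_ac)
  ultimately show ?thesis using 1 unfolding potential_def by linarith
qed

text \<open>
  A topmost unprocessed vertex \<open>x\<close> of \<open>band\<close> is chosen and the ideal is split along \<open>x\<close>.
  Dividing by \<open>x\<close> lowers the potential by 1, which pays for the increase allowed by the splitting;
  adding \<open>x\<close> does not raise it.
\<close>
lemma reg_le_potential:
  assumes "ancestor_closed L" "C \<subseteq> band" "S \<inter> L = {}"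
    and "\<And>v. v \<in> C \<Longrightarrow> 0 < lv v \<Longrightarrow> par v \<in> band \<Longrightarrow> par v \<in> C"
  shows "koszul_reg_le (squarefree_ideal (residual_edges L C S) :: ('v, 'k::comm_ring_1) mpoly set)
    (potential L C)"
  using assms
proof (induction "card (band \<inter> L - C)" arbitrary: L C S rule: less_induct)
  case less
  let ?U = "band \<inter> L - C"
  show ?case
  proof (cases "?U = {}")
    case True
    have "potential L C = (\<Sum>v\<in>tips L. h - lv v - 1)"
      unfolding potential_def True by simp
    moreover have "band \<inter> L \<subseteq> C" using True by blast
    ultimately show ?thesis
      using reg_le_base[of L C S, where 'k = 'k] less.prems(1) by simp
  next
    case False
    then obtain x where x: "x \<in> ?U" and min: "\<And>y. y \<in> ?U \<Longrightarrow> lv x \<le> lv y"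
      using ex_has_least_nat[of "\<lambda>y. y \<in> ?U" _ lv] by blast
    have xS: "x \<notin> S" "x \<notin> C" "x \<in> band" "x \<in> L" using x less.prems(3) by auto
    have less1: "card (band \<inter> L - insert x C) < card ?U"
      using x by (intro psubset_card_mono) auto
    have "x \<in> below x" by (auto simp: below_def intro: exI[of _ 0])
    then have less2: "card (band \<inter> (L - below x) - C) < card ?U"
      using x by (intro psubset_card_mono) auto
    have "?U = insert x (band \<inter> L - insert x C)" using x by auto
    then have "card ?U = Suc (card (band \<inter> L - insert x C))"
      by (metis Diff_iff card_insert_disjoint finite insertI1)
    then have r: "potential L C = Suc (potential L (insert x C))"
      by (simp add: potential_def)
    have "koszul_reg_le (squarefree_ideal (residual_edges L (insert x C) S) :: ('v, 'k) mpoly set)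
        (potential L (insert x C))"
    proof (rule less.hyps[OF less1])
      fix v assume v: "v \<in> insert x C" "0 < lv v" "par v \<in> band"
      show "par v \<in> insert x C"
      proof (cases "v = x")
        case True
        have "par x \<in> L" using less.prems(1) xS v(2) True by (auto simp: ancestor_closed_def)
        moreover have "lv (par x) < lv x" using lv_par[of x] v(2) True by simp
        ultimately show ?thesis using min[of "par x"] v(3) True by auto
      qed (use less.prems(4) v in auto)
    qed (use less.prems xS in auto)
    then have 1: "koszul_reg_le (squarefree_ideal (colon_edges x (residual_edges L C S)) :: ('v, 'k) mpoly set)
        (potential L (insert x C))"
      using xS by (simp add: colon_residual_edges)
    have "koszul_reg_le (squarefree_ideal (residual_edges (L - below x) C (insert x S)) :: ('v, 'k) mpoly set)
        (potential (L - below x) C)"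
      using less.prems \<open>x \<in> below x\<close>
      by (intro less.hyps[OF less2] ancestor_closed_diff_below) auto
    then have "koszul_reg_le (squarefree_ideal (residual_edges (L - below x) C (insert x S)) :: ('v, 'k) mpoly set)
        (potential L C)"
      by (rule koszul_reg_le_mono) (rule potential_diff_below[OF less.prems(1) x less.prems(4)])
    then have 2: "koszul_reg_le (squarefree_ideal (kill_edges x (residual_edges L C S)) :: ('v, 'k) mpoly set)
        (Suc (potential L (insert x C)))"
      unfolding kill_residual_edges[OF xS(3,2,1)] r .
    show ?thesis unfolding r by (rule koszul_reg_le_split[OF 1 2])
  qed
qed

theorem koszul_reg_le_paths:
  "koszul_reg_le (squarefree_ideal (path_to ` {v. t - 1 \<le> lv v}) :: ('v, 'k::comm_ring_1) mpoly set)
    (card band + (\<Sum>v | t - 1 \<le> lv v \<and> (\<forall>u. 0 < lv u \<longrightarrow> par u \<noteq> v). h - lv v - 1))"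
  using reg_le_potential[of UNIV "{}" "{}", where 'k = 'k]
  by (simp add: ancestor_closed_def residual_edges_def potential_def tips_def)

end

section \<open>Path ideals as squarefree monomial ideals\<close>
lemma prod_list_Var:
  "distinct p \<Longrightarrow> prod_list (map Var p) =
    (Poly_Mapping.single (\<Sum>v\<in>set p. Poly_Mapping.single v 1) 1 :: ('v, 'k::comm_ring_1) mpoly)"
  by (induction p) (simp_all add: Var_def mult_single)

lemma keys_sum_single:
  "finite A \<Longrightarrow> Poly_Mapping.keys (\<Sum>v\<in>A. Poly_Mapping.single v (1::nat)) = A"
  by (induction A rule: finite_induct) (simp_all add: keys_add_nat)

text \<open>
  The expansion of a polynomial into monomials, which reduces the membership in an ideal generated
  by monomials to that of terms.
\<close>
lemma sum_monomials:
  fixes f :: "('v, 'k::comm_ring_1) mpoly"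
  shows "f = (\<Sum>m\<in>Poly_Mapping.keys f. Poly_Mapping.single m (Poly_Mapping.lookup f m))"
proof (rule poly_mapping_eqI)
  fix k
  have "(\<Sum>m\<in>Poly_Mapping.keys f. Poly_Mapping.lookup (Poly_Mapping.single m (Poly_Mapping.lookup f m)) k)
      = (\<Sum>m\<in>Poly_Mapping.keys f. if m = k then Poly_Mapping.lookup f k else 0)"
    by (intro sum.cong) (auto simp: lookup_single when_def)
  then show "Poly_Mapping.lookup f k =
      Poly_Mapping.lookup (\<Sum>m\<in>Poly_Mapping.keys f. Poly_Mapping.single m (Poly_Mapping.lookup f m)) k"
    by (simp add: lookup_sum in_keys_iff)
qed

lemma subspace_squarefree_ideal:
  "Modules.module.subspace (*) (squarefree_ideal E :: ('v, 'k::comm_ring_1) mpoly set)"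
proof -
  interpret Modules.module "(*) :: ('v, 'k) mpoly \<Rightarrow> _" by (rule module_mult)
  show ?thesis
    by (intro subspaceI squarefree_ideal_0 squarefree_ideal_add squarefree_ideal_mult)
qed

lemma ideal_gen_eq_squarefree_ideal:
  fixes X :: "'v list set"
  assumes "\<And>p. p \<in> X \<Longrightarrow> distinct p"
  shows "ideal_gen ((\<lambda>p. prod_list (map Var p)) ` X) =
    (squarefree_ideal (set ` X) :: ('v, 'k::comm_ring_1) mpoly set)"
proof -
  interpret Modules.module "(*) :: ('v, 'k) mpoly \<Rightarrow> _" by (rule module_mult)
  let ?g = "\<lambda>p. prod_list (map Var p) :: ('v, 'k) mpoly"
  let ?x = "\<lambda>p. \<Sum>v\<in>set p. Poly_Mapping.single v (1::nat)"
  show ?thesis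
    unfolding ideal_gen_def
  proof
    have "?g p \<in> squarefree_ideal (set ` X)" if "p \<in> X" for p
    proof -
      have "Poly_Mapping.keys (?x p) = set p" by (rule keys_sum_single) simp
      then show ?thesis
        using that assms[OF that] by (auto simp: prod_list_Var squarefree_ideal_def)
    qed
    then show "span (?g ` X) \<subseteq> squarefree_ideal (set ` X)"
      by (intro span_minimal subspace_squarefree_ideal) auto
  next
    show "squarefree_ideal (set ` X) \<subseteq> span (?g ` X)"
    proof
      fix f :: "('v, 'k) mpoly" assume f: "f \<in> squarefree_ideal (set ` X)"
      have "Poly_Mapping.single m c \<in> span (?g ` X)" if "m \<in> Poly_Mapping.keys f" for m c
      proof -
        obtain p where p: "p \<in> X" "set p \<subseteq> Poly_Mapping.keys m"
          using squarefree_idealD[OF f \<open>m \<in> Poly_Mapping.keys f\<close>] by auto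
        have "(m - ?x p) + ?x p = m"
        proof (rule poly_mapping_eqI)
          fix v
          have "Poly_Mapping.lookup (?x p) v = (if v \<in> set p then 1 else 0)"
            by (simp add: lookup_sum lookup_single when_def)
          moreover have "v \<in> set p \<Longrightarrow> 0 < Poly_Mapping.lookup m v"
            using p(2) by (auto simp: in_keys_iff)
          ultimately show "Poly_Mapping.lookup ((m - ?x p) + ?x p) v = Poly_Mapping.lookup m v"
            by (simp add: lookup_add lookup_minus)
        qed
        then have "Poly_Mapping.single m c = Poly_Mapping.single (m - ?x p) c * ?g p"
          using assms[OF p(1)] by (simp add: prod_list_Var mult_single)
        then show ?thesis
          using p(1) by (simp add: span_scale span_base)
      qed
      then have "(\<Sum>m\<in>Poly_Mapping.keys f. Poly_Mapping.single m (Poly_Mapping.lookup f m)) \<in> span (?g ` X)"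
        by (intro span_sum)
      then show "f \<in> span (?g ` X)" using sum_monomials[of f] by simp
    qed
  qed
qed

section \<open>Rooted trees\<close>
lemma vpath_with_proj_iff:
  "vpath p (with_proj G) \<longleftrightarrow>
    set p \<subseteq> pverts G \<and> set (vwalk_arcs p) \<subseteq> parcs G \<and> p \<noteq> [] \<and> distinct p"
  by (auto simp: vpath_def vwalk_def)

lemma vpath_suffix: "vpath (q @ p) (with_proj G) \<Longrightarrow> p \<noteq> [] \<Longrightarrow> vpath p (with_proj G)"
  unfolding vpath_with_proj_iff using set_vwalk_arcs_append2[of p q] by auto

lemma vpath_prefix: "vpath (p @ q) (with_proj G) \<Longrightarrow> p \<noteq> [] \<Longrightarrow> vpath p (with_proj G)"
  unfolding vpath_with_proj_iff using set_vwalk_arcs_append1[of p q] by auto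

lemma vpath_snoc_arc:
  "vpath (q @ [y]) (with_proj G) \<Longrightarrow> q \<noteq> [] \<Longrightarrow> (last q, y) \<in> parcs G"
  unfolding vpath_with_proj_iff by (auto simp: vwalk_arcs_append)

definition parent :: "'v pair_pre_digraph \<Rightarrow> 'v \<Rightarrow> 'v" where
  "parent \<Gamma> y = (THE x. (x, y) \<in> parcs \<Gamma>)"

context
  fixes \<Gamma> :: "'v pair_pre_digraph" and x\<^sub>0 :: 'v
  assumes tree: "rooted_tree \<Gamma> x\<^sub>0"
begin

lemma root_in_verts: "x\<^sub>0 \<in> pverts \<Gamma>"
  using tree by (simp add: rooted_tree_def)

lemma wf_arcs: "(x, y) \<in> parcs \<Gamma> \<Longrightarrow> x \<in> pverts \<Gamma> \<and> y \<in> pverts \<Gamma>"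
proof -
  interpret pair_digraph \<Gamma> using tree by (simp add: rooted_tree_def)
  show "(x, y) \<in> parcs \<Gamma> \<Longrightarrow> x \<in> pverts \<Gamma> \<and> y \<in> pverts \<Gamma>"
    using wellformed' by blast
qed

lemma mem_mk_symmetric_iff:
  "(x, y) \<in> parcs (mk_symmetric \<Gamma>) \<longleftrightarrow> (x, y) \<in> parcs \<Gamma> \<or> (y, x) \<in> parcs \<Gamma>"
proof
  show "(x, y) \<in> parcs (mk_symmetric \<Gamma>)" if "(x, y) \<in> parcs \<Gamma> \<or> (y, x) \<in> parcs \<Gamma>"
    using that by (auto simp: parcs_mk_symmetric intro: bexI[of _ "(x, y)"] bexI[of _ "(y, x)"])
qed (auto simp: parcs_mk_symmetric)

lemma no_loop_arc: "(x, x) \<notin> parcs \<Gamma>"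
  using tree by (auto simp: rooted_tree_def)

lemma arc_orientation:
  "(x, y) \<in> parcs \<Gamma> \<Longrightarrow> vpath p (mk_symmetric \<Gamma>) \<Longrightarrow> hd p = x\<^sub>0 \<Longrightarrow> last p = y \<Longrightarrow> x \<in> set p"
  using tree unfolding rooted_tree_def by blast

text \<open>
  If the path used an arc against its direction, the orientation condition would place the tail of
  that arc on the part of the path already traversed.
\<close>
lemma vpath_mk_symmetric_root_directed:
  "vpath p (mk_symmetric \<Gamma>) \<Longrightarrow> hd p = x\<^sub>0 \<Longrightarrow> vpath p \<Gamma>"
proof (induction p rule: rev_induct)
  case (snoc y q)
  show ?case
  proof (cases "q = []")
    case True
    then show ?thesis using snoc.prems by (simp add: vpath_with_proj_iff)
  next
    case False
    have q: "vpath q (mk_symmetric \<Gamma>)" using vpath_prefix[OF snoc.prems(1) False] .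
    have hd: "hd q = x\<^sub>0" using snoc.prems(2) False by simp
    have "vpath q \<Gamma>" using snoc.IH q hd by blast
    moreover have "(last q, y) \<in> parcs \<Gamma>"
    proof -
      have "y \<notin> set q" using snoc.prems(1) by (simp add: vpath_with_proj_iff)
      then have "(y, last q) \<notin> parcs \<Gamma>" using arc_orientation[OF _ q hd] by blast
      then show ?thesis
        using vpath_snoc_arc[OF snoc.prems(1) False] mem_mk_symmetric_iff by blast
    qed
    ultimately show ?thesis
      using snoc.prems(1) False by (auto simp: vpath_with_proj_iff vwalk_arcs_append)
  qed
qed (simp add: vpath_with_proj_iff)

lemma vpath_directed_mk_symmetric: "vpath p \<Gamma> \<Longrightarrow> vpath p (mk_symmetric \<Gamma>)"
  unfolding vpath_with_proj_iff using mem_mk_symmetric_iff by auto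

lemma directed_path_exists:
  assumes "y \<in> pverts \<Gamma>"
  shows "\<exists>p. vpath p \<Gamma> \<and> hd p = x\<^sub>0 \<and> last p = y"
proof -
  interpret pair_digraph \<Gamma> using tree by (simp add: rooted_tree_def)
  interpret S: pair_wf_digraph "mk_symmetric \<Gamma>" by (rule wellformed_mk_symmetric)
  have "strongly_connected (mk_symmetric \<Gamma>)"
    using tree by (simp add: rooted_tree_def connected_def)
  then have "x\<^sub>0 \<rightarrow>\<^sup>*\<^bsub>with_proj (mk_symmetric \<Gamma>)\<^esub> y"
    using assms root_in_verts by (simp add: strongly_connected_def)
  then obtain p where "vpath p (mk_symmetric \<Gamma>)" "hd p = x\<^sub>0" "last p = y"
    unfolding S.reachable_vpath_conv by blast
  then show ?thesis using vpath_mk_symmetric_root_directed by blast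
qed

text \<open>
  By the orientation condition \<open>x\<close> lies on the path to \<open>y\<close>; if it were not the vertex before
  \<open>y\<close>, the arc would close a cycle.
\<close>
lemma arc_last_step:
  assumes "(x, y) \<in> parcs \<Gamma>" "vpath p \<Gamma>" "hd p = x\<^sub>0" "last p = y"
  shows "\<exists>q. p = q @ [x, y]"
proof -
  have p: "vpath p (mk_symmetric \<Gamma>)" using assms(2) by (rule vpath_directed_mk_symmetric)
  then obtain q r where qr: "p = q @ x # r"
    using arc_orientation[OF assms(1) p assms(3,4)] by (meson split_list)
  have "r \<noteq> []" using qr assms(1,4) no_loop_arc by auto
  have c: "vpath (x # r) (mk_symmetric \<Gamma>)" using vpath_suffix[of q "x # r"] p qr by simp
  have "last (x # r) = y" using qr assms(4) by simp
  then have "(last (x # r), hd (x # r)) \<in> parcs (mk_symmetric \<Gamma>)"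
    using assms(1) mem_mk_symmetric_iff by simp
  then have "\<not> length (x # r) \<ge> 3"
    using tree c unfolding rooted_tree_def by blast
  then have "r = [y]"
    using \<open>r \<noteq> []\<close> \<open>last (x # r) = y\<close> by (cases r; cases "tl r") auto
  then show ?thesis using qr by simp
qed

lemma unique_parent:
  assumes "(x, y) \<in> parcs \<Gamma>" "(x', y) \<in> parcs \<Gamma>"
  shows "x = x'"
proof -
  obtain p where p: "vpath p \<Gamma>" "hd p = x\<^sub>0" "last p = y"
    using directed_path_exists wf_arcs[OF assms(1)] by blast
  show ?thesis
    using arc_last_step[OF assms(1) p] arc_last_step[OF assms(2) p] by auto
qed

lemma parent_eq: "(x, y) \<in> parcs \<Gamma> \<Longrightarrow> parent \<Gamma> y = x"
  unfolding parent_def using unique_parent by blast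

lemma no_arc_to_root: "(x, x\<^sub>0) \<notin> parcs \<Gamma>"
proof
  assume arc: "(x, x\<^sub>0) \<in> parcs \<Gamma>"
  have "vpath [x\<^sub>0] \<Gamma>" using root_in_verts by (simp add: vpath_with_proj_iff)
  from arc_last_step[OF arc this] show False by simp
qed

lemma directed_path_unique:
  "vpath p \<Gamma> \<Longrightarrow> hd p = x\<^sub>0 \<Longrightarrow> vpath p' \<Gamma> \<Longrightarrow> hd p' = x\<^sub>0 \<Longrightarrow> last p = last p' \<Longrightarrow> p = p'"
proof (induction p arbitrary: p' rule: rev_induct)
  case (snoc y q)
  have p': "p' = butlast p' @ [y]"
    using snoc.prems by (metis append_butlast_last_id last_snoc vpath_with_proj_iff)
  show ?case
  proof (cases "q = []")
    case True
    have "butlast p' = []"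
    proof (rule ccontr)
      assume "butlast p' \<noteq> []"
      then have "(last (butlast p'), y) \<in> parcs \<Gamma>" using vpath_snoc_arc p' snoc.prems(3) by metis
      then show False using True snoc.prems(2) no_arc_to_root by simp
    qed
    then show ?thesis using p' True by simp
  next
    case False
    then have arc: "(last q, y) \<in> parcs \<Gamma>" using vpath_snoc_arc snoc.prems(1) by metis
    have "butlast p' \<noteq> []"
    proof
      assume "butlast p' = []"
      then have "y = x\<^sub>0" using p' snoc.prems(4) by (metis append_Nil list.sel(1))
      then show False using arc no_arc_to_root by simp
    qed
    moreover from this have "(last (butlast p'), y) \<in> parcs \<Gamma>"
      using vpath_snoc_arc p' snoc.prems(3) by metis
    moreover have "vpath (butlast p') \<Gamma>"
      using \<open>butlast p' \<noteq> []\<close> vpath_prefix p' snoc.prems(3) by metis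
    moreover have "hd (butlast p') = x\<^sub>0"
      using \<open>butlast p' \<noteq> []\<close> p' snoc.prems(4) by (metis hd_append2)
    ultimately have "q = butlast p'"
      using snoc.prems False arc unique_parent vpath_prefix[OF snoc.prems(1) False]
      by (intro snoc.IH) auto
    then show ?thesis using p' by simp
  qed
qed (simp add: vpath_with_proj_iff)

lemma level_eq: "vpath p \<Gamma> \<Longrightarrow> hd p = x\<^sub>0 \<Longrightarrow> last p = y \<Longrightarrow> level \<Gamma> x\<^sub>0 y = length p - 1"
proof -
  assume p: "vpath p \<Gamma>" "hd p = x\<^sub>0" "last p = y"
  then have "(THE p. vpath p \<Gamma> \<and> hd p = x\<^sub>0 \<and> last p = y) = p"
    using directed_path_unique by (intro the_equality) auto
  then show ?thesis by (simp add: level_def)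
qed

lemma level_arc:
  assumes "(x, y) \<in> parcs \<Gamma>"
  shows "level \<Gamma> x\<^sub>0 y = Suc (level \<Gamma> x\<^sub>0 x)"
proof -
  obtain p where p: "vpath p \<Gamma>" "hd p = x\<^sub>0" "last p = y"
    using directed_path_exists wf_arcs[OF assms] by blast
  then obtain q where q: "p = (q @ [x]) @ [y]" using arc_last_step[OF assms p] by auto
  have "vpath (q @ [x]) \<Gamma>" using p(1) unfolding q by (rule vpath_prefix) simp
  moreover have "hd (q @ [x]) = x\<^sub>0" using p(2) unfolding q by (cases q) auto
  ultimately show ?thesis using level_eq[OF p] level_eq[of "q @ [x]" x] q by simp
qed

lemma level_eq_0_iff:
  assumes "y \<in> pverts \<Gamma>"
  shows "level \<Gamma> x\<^sub>0 y = 0 \<longleftrightarrow> y = x\<^sub>0"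
proof -
  obtain p where p: "vpath p \<Gamma>" "hd p = x\<^sub>0" "last p = y"
    using directed_path_exists[OF assms] by blast
  have "vpath [x\<^sub>0] \<Gamma>" using root_in_verts by (simp add: vpath_with_proj_iff)
  then have "level \<Gamma> x\<^sub>0 x\<^sub>0 = 0" using level_eq[of "[x\<^sub>0]" x\<^sub>0] by simp
  moreover have "y = x\<^sub>0" if "level \<Gamma> x\<^sub>0 y = 0"
  proof -
    have "length p \<le> 1" using that level_eq[OF p] by simp
    moreover have "p \<noteq> []" using p(1) by (simp add: vpath_with_proj_iff)
    ultimately obtain z where "p = [z]" by (cases p) auto
    then show ?thesis using p by simp
  qed
  ultimately show ?thesis by auto
qed

lemma parent_arc_iff:
  assumes "y \<in> pverts \<Gamma>"
  shows "(x, y) \<in> parcs \<Gamma> \<longleftrightarrow> 0 < level \<Gamma> x\<^sub>0 y \<and> parent \<Gamma> y = x"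
proof
  assume "(x, y) \<in> parcs \<Gamma>"
  then show "0 < level \<Gamma> x\<^sub>0 y \<and> parent \<Gamma> y = x" using parent_eq level_arc by simp
next
  assume y: "0 < level \<Gamma> x\<^sub>0 y \<and> parent \<Gamma> y = x"
  obtain p where p: "vpath p \<Gamma>" "hd p = x\<^sub>0" "last p = y"
    using directed_path_exists[OF assms] by blast
  then have "p = butlast p @ [y]"
    by (metis append_butlast_last_id vpath_with_proj_iff)
  moreover have "butlast p \<noteq> []"
    using y level_eq[OF p] by (metis length_butlast length_greater_0_conv)
  ultimately have "(last (butlast p), y) \<in> parcs \<Gamma>"
    using vpath_snoc_arc p(1) by metis
  then show "(x, y) \<in> parcs \<Gamma>" using y parent_eq[of "last (butlast p)" y] by simp
qed

text \<open>
  A directed path is recovered from its last vertex by passing to parents.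
\<close>
lemma vpath_set_eq:
  assumes "vpath p \<Gamma>"
  shows "set p = (\<lambda>i. (parent \<Gamma> ^^ i) (last p)) ` {..<length p}
    \<and> hd p = (parent \<Gamma> ^^ (length p - 1)) (last p)
    \<and> length p - 1 \<le> level \<Gamma> x\<^sub>0 (last p) \<and> level \<Gamma> x\<^sub>0 (last p) = level \<Gamma> x\<^sub>0 (hd p) + (length p - 1)"
  using assms
proof (induction p)
  case (Cons u q)
  show ?case
  proof (cases "q = []")
    case True
    then show ?thesis by (simp add: lessThan_Suc)
  next
    case False
    have q: "vpath q \<Gamma>" using vpath_suffix[of "[u]" q] Cons.prems False by simp
    have arc: "(u, hd q) \<in> parcs \<Gamma>"
      using Cons.prems False by (simp add: vpath_with_proj_iff)
    define k where "k = length q - 1"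
    have k: "length q = Suc k" using False by (cases q) (auto simp: k_def)
    have u: "u = (parent \<Gamma> ^^ Suc k) (last q)"
      using Cons.IH[OF q] parent_eq[OF arc] by (simp add: k_def)
    show ?thesis
      using Cons.IH[OF q] level_arc[OF arc] False u
      by (auto simp: k lessThan_Suc)
  qed
qed (simp add: vpath_with_proj_iff)

lemma vpath_sets_eq:
  assumes "1 \<le> t"
  shows "set ` {p. vpath p \<Gamma> \<and> length p = t} =
    (\<lambda>v. (\<lambda>i. (parent \<Gamma> ^^ i) v) ` {..<t}) ` {v \<in> pverts \<Gamma>. t - 1 \<le> level \<Gamma> x\<^sub>0 v}"
    (is "?L = ?R")
proof (intro equalityI subsetI)
  fix e assume "e \<in> ?L"
  then obtain p where p: "vpath p \<Gamma>" "length p = t" "e = set p" by auto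
  moreover have "last p \<in> pverts \<Gamma>" using p(1) unfolding vpath_with_proj_iff by auto
  ultimately show "e \<in> ?R" using vpath_set_eq[OF p(1)] by auto
next
  fix e assume "e \<in> ?R"
  then obtain v where v: "v \<in> pverts \<Gamma>" "t - 1 \<le> level \<Gamma> x\<^sub>0 v"
    and e: "e = (\<lambda>i. (parent \<Gamma> ^^ i) v) ` {..<t}" by auto
  obtain p where p: "vpath p \<Gamma>" "hd p = x\<^sub>0" "last p = v"
    using directed_path_exists[OF v(1)] by blast
  have lp: "t \<le> length p"
    using v(2) level_eq[OF p] p(1) assms by (cases p) (auto simp: vpath_with_proj_iff)
  define q where "q = drop (length p - t) p"
  have len: "length q = t" using lp by (simp add: q_def)
  then have ne: "q \<noteq> []" using assms by auto
  have q: "vpath q \<Gamma>"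
    using vpath_suffix[of "take (length p - t) p" q \<Gamma>] p(1) ne by (simp add: q_def)
  have "last q = v" using p(3) ne by (simp add: q_def last_drop)
  then have "set q = e" using vpath_set_eq[OF q] len e by simp
  then show "e \<in> ?L" using q len by blast
qed

lemma out_degree_eq: "out_degree \<Gamma> x = card {y. (x, y) \<in> parcs \<Gamma>}"
proof -
  have "out_arcs \<Gamma> x = (\<lambda>y. (x, y)) ` {y. (x, y) \<in> parcs \<Gamma>}"
    by (force simp: out_arcs_def)
  then show ?thesis
    unfolding out_degree_def by (simp add: card_image inj_on_def)
qed

end

section \<open>The regularity bound\<close>
theorem theoremC:
  fixes \<Gamma> :: "'v::finite pair_pre_digraph" and x\<^sub>0 :: 'v and t :: nat
  assumes "rooted_tree \<Gamma> x\<^sub>0"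
    and "pverts \<Gamma> = UNIV"
    and "height \<Gamma> x\<^sub>0 \<ge> 1"
    and "t \<ge> 1"
    and "\<lceil>(real (height \<Gamma> x\<^sub>0) + 1) / 2\<rceil> \<le> int t"
    and "t \<le> height \<Gamma> x\<^sub>0 + 1"
  shows "reg_quotient (path_ideal t \<Gamma> :: ('v, 'k::field) mpoly set) \<le>
    ereal (of_int (
      (\<Sum>i = int (height \<Gamma> x\<^sub>0) - int t .. int (height \<Gamma> x\<^sub>0) - 2.
         if i = -1 then 1 else \<Sum>x \<in> level_set \<Gamma> x\<^sub>0 i. int (out_degree \<Gamma> x)) +
      (\<Sum>i = int t - 1 .. int (height \<Gamma> x\<^sub>0) - 2.
         (int (height \<Gamma> x\<^sub>0) - i - 1) * int (num_leaves_at \<Gamma> x\<^sub>0 i))))"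
proof -
  let ?lv = "level \<Gamma> x\<^sub>0" and ?par = "parent \<Gamma>" and ?h = "height \<Gamma> x\<^sub>0"
  note tree = assms(1)
  have arc_iff: "(x, y) \<in> parcs \<Gamma> \<longleftrightarrow> 0 < ?lv y \<and> ?par y = x" for x y
    using parent_arc_iff[OF tree] assms(2) by simp
  interpret leveled_tree ?par ?lv ?h t
  proof
    show "?lv (?par v) = ?lv v - 1" if "0 < ?lv v" for v
      using level_arc[OF tree, of "?par v" v] that by (simp add: arc_iff)
    show "?lv v \<le> ?h" for v
      unfolding height_def assms(2) by (intro Max_ge) auto
    have "(real ?h + 1) / 2 \<le> real t"
      using assms(5) by (simp add: ceiling_le_iff)
    then have "real (?h + 1) \<le> real (2 * t)" by simp
    then show "?h + 1 \<le> 2 * t" by (simp only: of_nat_le_iff)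
  qed (use assms in auto)
  let ?C = "{v. t - 1 \<le> ?lv v \<and> (\<forall>u. 0 < ?lv u \<longrightarrow> ?par u \<noteq> v)}"
  have ideal: "(path_ideal t \<Gamma> :: ('v, 'k) mpoly set) = squarefree_ideal (path_to ` {v. t - 1 \<le> ?lv v})"
  proof -
    have "(path_ideal t \<Gamma> :: ('v, 'k) mpoly set) =
        ideal_gen ((\<lambda>p. prod_list (map Var p)) ` {p. vpath p \<Gamma> \<and> length p = t})"
      unfolding path_ideal_def by (intro arg_cong[of _ _ ideal_gen]) auto
    also have "\<dots> = squarefree_ideal (set ` {p. vpath p \<Gamma> \<and> length p = t})"
      by (intro ideal_gen_eq_squarefree_ideal) (auto simp: vpath_def)
    finally show ?thesis
      using vpath_sets_eq[OF tree assms(4)] assms(2) by (simp add: path_to_def[abs_def])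
  qed
  have bound: "reg_quotient (path_ideal t \<Gamma> :: ('v, 'k) mpoly set) \<le>
      ereal (of_int (int (card band + (\<Sum>v\<in>?C. ?h - ?lv v - 1))))"
    unfolding ideal by (intro reg_quotient_le subspace_squarefree_ideal koszul_reg_le_paths)
  \<comment> \<open>The outdegrees at level \<open>i\<close> count the vertices at level \<open>i + 1\<close>; for \<open>i = - 1\<close> these are
    the root alone.\<close>
  have band_sum: "int (card band) = (\<Sum>i = int ?h - int t .. int ?h - 2.
         if i = -1 then 1 else \<Sum>x \<in> level_set \<Gamma> x\<^sub>0 i. int (out_degree \<Gamma> x))"
  proof -
    have summand: "(if i = -1 then 1 else \<Sum>x \<in> level_set \<Gamma> x\<^sub>0 i. int (out_degree \<Gamma> x)) =
        int (card {y. int (?lv y) = i + 1})" if i: "i \<ge> -1" for i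
    proof (cases "i = -1")
      case True
      have "{y. int (?lv y) = 0} = {x\<^sub>0}"
        using level_eq_0_iff[OF tree] assms(2) by auto
      then show ?thesis using True by simp
    next
      case False
      then have i: "0 \<le> i" using i by simp
      have "{y. int (?lv y) = i + 1} = (\<Union>x\<in>level_set \<Gamma> x\<^sub>0 i. {y. (x, y) \<in> parcs \<Gamma>})"
      proof (intro equalityI subsetI)
        fix y assume "y \<in> {y. int (?lv y) = i + 1}"
        then have y: "int (?lv y) = i + 1" by simp
        then have arc: "(?par y, y) \<in> parcs \<Gamma>" using i by (auto simp: arc_iff)
        then have "?par y \<in> level_set \<Gamma> x\<^sub>0 i"
          using level_arc[OF tree arc] y assms(2) by (simp add: level_set_def)
        then show "y \<in> (\<Union>x\<in>level_set \<Gamma> x\<^sub>0 i. {y. (x, y) \<in> parcs \<Gamma>})" using arc by blast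
      next
        fix y assume "y \<in> (\<Union>x\<in>level_set \<Gamma> x\<^sub>0 i. {y. (x, y) \<in> parcs \<Gamma>})"
        then show "y \<in> {y. int (?lv y) = i + 1}"
          using level_arc[OF tree] by (auto simp: level_set_def)
      qed
      moreover have "card (\<Union>x\<in>level_set \<Gamma> x\<^sub>0 i. {y. (x, y) \<in> parcs \<Gamma>}) =
          (\<Sum>x\<in>level_set \<Gamma> x\<^sub>0 i. card {y. (x, y) \<in> parcs \<Gamma>})"
        by (intro card_UN_disjoint) (auto simp: arc_iff)
      ultimately show ?thesis
        using False by (simp add: out_degree_eq[OF tree])
    qed
    have "band = (\<Union>i\<in>{int ?h - int t .. int ?h - 2}. {y. int (?lv y) = i + 1})"
    proof (intro equalityI subsetI)
      fix y assume "y \<in> band"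
      then have "int (?lv y) - 1 \<in> {int ?h - int t .. int ?h - 2}"
        by (auto simp: band_def)
      then show "y \<in> (\<Union>i\<in>{int ?h - int t .. int ?h - 2}. {y. int (?lv y) = i + 1})" by (rule UN_I) simp
    qed (use t_bounds in \<open>auto simp: band_def\<close>)
    then have "card band = (\<Sum>i\<in>{int ?h - int t .. int ?h - 2}. card {y. int (?lv y) = i + 1})"
      by (simp only:) (intro card_UN_disjoint; auto)
    then have "int (card band) = (\<Sum>i\<in>{int ?h - int t .. int ?h - 2}. int (card {y. int (?lv y) = i + 1}))"
      by simp
    also have "\<dots> = (\<Sum>i = int ?h - int t .. int ?h - 2.
         if i = -1 then 1 else \<Sum>x \<in> level_set \<Gamma> x\<^sub>0 i. int (out_degree \<Gamma> x))"
      using t_bounds by (intro sum.cong refl summand[symmetric]) auto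
    finally show ?thesis .
  qed
  \<comment> \<open>The subtraction of natural numbers makes the leaves at levels \<open>h - 1\<close> and \<open>h\<close> contribute 0.\<close>
  have leaf_sum: "int (\<Sum>v\<in>?C. ?h - ?lv v - 1) = (\<Sum>i = int t - 1 .. int ?h - 2.
         (int ?h - i - 1) * int (num_leaves_at \<Gamma> x\<^sub>0 i))"
  proof -
    let ?I = "{int t - 1 .. int ?h - 2}" and ?S = "\<lambda>i. {x \<in> level_set \<Gamma> x\<^sub>0 i. leaf \<Gamma> x}"
    have leaf_iff: "leaf \<Gamma> v \<longleftrightarrow> (\<forall>u. 0 < ?lv u \<longrightarrow> ?par u \<noteq> v)" for v
    proof -
      have "leaf \<Gamma> v \<longleftrightarrow> {y. (v, y) \<in> parcs \<Gamma>} = {}"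
        using assms(2) by (simp add: leaf_def out_degree_eq[OF tree])
      then show ?thesis unfolding arc_iff by blast
    qed
    have "int (\<Sum>v\<in>?C. ?h - ?lv v - 1) = (\<Sum>v\<in>?C. int (?h - ?lv v - 1))" by simp
    also have "\<dots> = (\<Sum>v\<in>(\<Union>i\<in>?I. ?S i). int (?h - ?lv v - 1))"
    proof (intro sum.mono_neutral_right)
      show "(\<Union>i\<in>?I. ?S i) \<subseteq> ?C"
        by (auto simp: level_set_def leaf_iff)
      show "\<forall>v\<in>?C - (\<Union>i\<in>?I. ?S i). int (?h - ?lv v - 1) = 0"
      proof
        fix v assume v: "v \<in> ?C - (\<Union>i\<in>?I. ?S i)"
        then have "v \<in> ?S (int (?lv v))" using assms(2) by (auto simp: level_set_def leaf_iff)
        then have "int (?lv v) \<notin> ?I" using v by blast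
        then show "int (?h - ?lv v - 1) = 0" using v by auto
      qed
    qed simp
    also have "\<dots> = (\<Sum>i\<in>?I. \<Sum>v\<in>?S i. int (?h - ?lv v - 1))"
      by (intro sum.UNION_disjoint) (auto simp: level_set_def)
    also have "\<dots> = (\<Sum>i\<in>?I. (int ?h - i - 1) * int (num_leaves_at \<Gamma> x\<^sub>0 i))"
    proof (intro sum.cong refl)
      fix i assume i: "i \<in> ?I"
      have "(\<Sum>v\<in>?S i. int (?h - ?lv v - 1)) = (\<Sum>v\<in>?S i. int ?h - i - 1)"
        using i by (intro sum.cong) (auto simp: level_set_def)
      then show "(\<Sum>v\<in>?S i. int (?h - ?lv v - 1)) = (int ?h - i - 1) * int (num_leaves_at \<Gamma> x\<^sub>0 i)"
        by (simp add: num_leaves_at_def)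
    qed
    finally show ?thesis .
  qed
  show ?thesis
    using bound unfolding of_nat_add band_sum leaf_sum .
qed

end
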